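(* Each Taylor--Socolar tiling $\Lambda\in X_Q$ and its corresponding parity tiling (the coloring $Q\to\{\text{white},\text{gray}\}$ that records only whether the tile of $\Lambda$ at $x\in Q$ is white or gray) are mutually locally derivable.
   Context: Lattices. $a_1=(1,0)$, $a_2=(-\tfrac12,\tfrac{\sqrt3}2)$, $Q=\mathbb Za_1+\mathbb Za_2\subset\mathbb R^2$, $w_1=\tfrac23a_1+\tfrac13a_2$, $w_2=\tfrac13a_1+\tfrac23a_2$, $\Omega=\{\pm w_1,\pm w_2,\pm(w_2-w_1)\}$. Tiles and matching rules. The hexagon $H_x$ at $x\in Q$ is the regular hexagon with center $x$ and vertices $x+w$, $w\in\Omega$. A marked tile at $x$ is given by: a stripe direction (one of the lines $\mathbb Ra_1,\mathbb Ra_2,\mathbb R(a_1+a_2)$); a black stripe across $H_x$ parallel to that direction and displaced from $x$ by a fixed small $\epsilon>0$ ($0<\epsilon\le1/4$) to one of the two sides; two further black V-shaped lines, one on each side, each joining the two hexagon edges adjacent to the vertex of $H_x$ lying on that side on the long diagonal perpendicular to the stripe direction, with legs perpendicular to these edges and displaced by $\epsilon$ from the edge midpoints towards that vertex; the long diagonal at angle $\pi/6$ clockwise from the stripe direction colored red, the one at $\pi/6$ counterclockwise colored blue, and the one perpendicular to the stripe direction colored half red and half blue (either way around, split at $x$). The tile is white if the displaced stripe crosses the red half of the split diagonal and gray if it crosses the blue half. $X_Q$, the set of Taylor--Socolar tilings centered on $Q$, is the set of all choices of a marked tile at every $x\in Q$ such that: (R1) on each common edge of two adjacent hexagons the black lines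 of the two tiles meet (same displacement from the edge midpoint); (R2) for all $x\in Q$, $w\in\Omega$, the color at the end $x+w$ of the diagonal of $H_x$ and the color at the end $x+2w$ of the diagonal of $H_{x+3w}$ are opposite. Local derivability. A tiling $B$ on $Q$ is locally derivable from a tiling $A$ on $Q$ if there is $R>0$ such that whenever $x,y\in Q$ and the patches of $A$ in the balls of radius $R$ around $x$ and $y$ agree up to the translation by $y-x$, the tiles of $B$ at $x$ and $y$ agree up to that translation. $A$ and $B$ are mutually locally derivable if each is locally derivable from the other. *)

theory Defs
  imports "HOL-Analysis.Analysis"
begin

text \<open>The plane is identified with the complex numbers, so that multiplication by
  \<^term>\<open>cis t\<close> is the counterclockwise rotation by the angle \<^term>\<open>t\<close>.\<close>

definition a1 :: complex where "a1 = Complex 1 0"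
definition a2 :: complex where "a2 = Complex (- 1 / 2) (sqrt 3 / 2)"

definition Q_lattice :: "complex set" where
  "Q_lattice = {of_int m * a1 + of_int n * a2 | m n. True}"

definition w1 :: complex where "w1 = (2 / 3) * a1 + (1 / 3) * a2"
definition w2 :: complex where "w2 = (1 / 3) * a1 + (2 / 3) * a2"

definition Omega :: "complex set" where
  "Omega = {w1, - w1, w2, - w2, w2 - w1, - (w2 - w1)}"

definition hexagon :: "complex \<Rightarrow> complex set" where
  "hexagon x = convex hull ((+) x ` Omega)"

definition adjacent :: "complex \<Rightarrow> complex \<Rightarrow> bool" where
  "adjacent x y \<longleftrightarrow> y - x \<in> {a1, - a1, a2, - a2, a1 + a2, - (a1 + a2)}"


section \<open>Marked tiles\<close>

text \<open>A marked tile is recorded up to translation, by its three independent choices. All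
  its markings below are drawn in the hexagon centered at the origin.\<close>

datatype direction = Along_a1 | Along_a2 | Along_a1_a2
datatype side = Left | Right

datatype tile = Tile
  (stripe_direction: direction)
  (stripe_side: side)  \<comment> \<open>the side to which the stripe is displaced\<close>
  (red_side: side)  \<comment> \<open>the side of the red half of the split diagonal\<close>

fun direction_vector :: "direction \<Rightarrow> complex" where
  "direction_vector Along_a1 = a1"
| "direction_vector Along_a2 = a2"
| "direction_vector Along_a1_a2 = a1 + a2"

fun opposite_side :: "side \<Rightarrow> side" where
  "opposite_side Left = Right"
| "opposite_side Right = Left"

text \<open>The direction vectors have length 1, and the circumradius of the hexagon is
  \<^term>\<open>1 / sqrt 3\<close>.\<close>

fun side_normal :: "direction \<Rightarrow> side \<Rightarrow> complex" where
  "side_normal d Left = \<i> * direction_vector d"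
| "side_normal d Right = - \<i> * direction_vector d"

definition side_vertex :: "direction \<Rightarrow> side \<Rightarrow> complex" where
  "side_vertex d s = side_normal d s / of_real (sqrt 3)"


subsection \<open>Black lines\<close>

text \<open>The two edges of the hexagon orthogonal to a direction vector \<open>d\<close> have midpoints
  \<open>d / 2\<close> and \<open>- d / 2\<close>.\<close>

definition stripe :: "real \<Rightarrow> tile \<Rightarrow> complex set" where
  "stripe eps t =
    (let d = direction_vector (stripe_direction t);
         n = side_normal (stripe_direction t) (stripe_side t)
     in closed_segment (- d / 2 + of_real eps * n) (d / 2 + of_real eps * n))"

text \<open>The leg at the edge from the vertex \<open>v\<close> to the neighboring vertex \<open>v'\<close>. The line
  orthogonal to this edge at distance \<open>eps\<close> from its midpoint \<open>m\<close>, on the side of \<open>v\<close>, meets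
  the diagonal through \<open>v\<close> at distance \<open>2 * eps\<close> from the center: it is parallel to \<open>m\<close>,
  hence makes an angle of \<open>pi / 6\<close> with the diagonal, and it passes at distance \<open>eps\<close> from the
  center.\<close>

definition V_leg :: "real \<Rightarrow> complex \<Rightarrow> complex \<Rightarrow> complex set" where
  "V_leg eps v v' =
    (let m = (v + v') / 2
     in closed_segment (m + of_real eps * sgn (v - m)) (of_real (2 * eps) * sgn v))"

definition V_line :: "real \<Rightarrow> complex \<Rightarrow> complex set" where
  "V_line eps v = V_leg eps v (cis (pi / 3) * v) \<union> V_leg eps v (cis (- pi / 3) * v)"

definition black_lines :: "real \<Rightarrow> tile \<Rightarrow> complex set" where
  "black_lines eps t =
    stripe eps t \<union> (\<Union>s. V_line eps (side_vertex (stripe_direction t) s))"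


subsection \<open>Colored diagonals\<close>

definition long_diagonal :: "complex \<Rightarrow> complex set" where
  "long_diagonal u =
    closed_segment (- u / of_real (sqrt 3)) (u / of_real (sqrt 3))"

definition red_half :: "tile \<Rightarrow> complex set" where
  "red_half t = closed_segment 0 (side_vertex (stripe_direction t) (red_side t))"

definition blue_half :: "tile \<Rightarrow> complex set" where
  "blue_half t =
    closed_segment 0 (side_vertex (stripe_direction t) (opposite_side (red_side t)))"

definition red_lines :: "tile \<Rightarrow> complex set" where
  "red_lines t =
    long_diagonal (cis (- pi / 6) * direction_vector (stripe_direction t)) \<union> red_half t"

definition blue_lines :: "tile \<Rightarrow> complex set" where
  "blue_lines t =
    long_diagonal (cis (pi / 6) * direction_vector (stripe_direction t)) \<union> blue_half t"

datatype parity = White | Gray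

text \<open>The stripe meets exactly one of the two halves of the split diagonal, so the tile is gray
  exactly if the stripe crosses the blue half.\<close>

definition tile_parity :: "real \<Rightarrow> tile \<Rightarrow> parity" where
  "tile_parity eps t = (if stripe eps t \<inter> red_half t \<noteq> {} then White else Gray)"


section \<open>Taylor--Socolar tilings\<close>

text \<open>A tiling is a function on the plane of which only the values on \<^const>\<open>Q_lattice\<close>
  matter.\<close>

definition R1 :: "real \<Rightarrow> (complex \<Rightarrow> tile) \<Rightarrow> bool" where
  "R1 eps \<Lambda> \<longleftrightarrow> (\<forall>x\<in>Q_lattice. \<forall>y\<in>Q_lattice. adjacent x y \<longrightarrow>
    (let E = hexagon x \<inter> hexagon y
     in (+) x ` black_lines eps (\<Lambda> x) \<inter> E = (+) y ` black_lines eps (\<Lambda> y) \<inter> E))"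

text \<open>The end \<^term>\<open>x + 2 * w\<close> of the diagonal of the hexagon at \<^term>\<open>x + 3 * w\<close> is at
  \<^term>\<open>- w\<close> relative to the center of that hexagon.\<close>

definition R2 :: "(complex \<Rightarrow> tile) \<Rightarrow> bool" where
  "R2 \<Lambda> \<longleftrightarrow> (\<forall>x\<in>Q_lattice. \<forall>w\<in>Omega.
    (w \<in> red_lines (\<Lambda> x) \<and> - w \<in> blue_lines (\<Lambda> (x + 3 * w))) \<or>
    (w \<in> blue_lines (\<Lambda> x) \<and> - w \<in> red_lines (\<Lambda> (x + 3 * w))))"

definition X_Q :: "real \<Rightarrow> (complex \<Rightarrow> tile) set" where
  "X_Q eps = {\<Lambda>. R1 eps \<Lambda> \<and> R2 \<Lambda>}"

definition parity_tiling :: "real \<Rightarrow> (complex \<Rightarrow> tile) \<Rightarrow> complex \<Rightarrow> parity" where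
  "parity_tiling eps \<Lambda> x = tile_parity eps (\<Lambda> x)"


section \<open>Local derivability\<close>

text \<open>Tiles are recorded up to translation, so agreement up to translation is equality of the
  recorded values.\<close>

definition locally_derivable_from :: "(complex \<Rightarrow> 'b) \<Rightarrow> (complex \<Rightarrow> 'a) \<Rightarrow> bool" where
  "locally_derivable_from B A \<longleftrightarrow> (\<exists>R>0. \<forall>x\<in>Q_lattice. \<forall>y\<in>Q_lattice.
    (\<forall>z\<in>Q_lattice \<inter> cball x R. A z = A (z + (y - x))) \<longrightarrow> B x = B y)"

definition mutually_locally_derivable :: "(complex \<Rightarrow> 'a) \<Rightarrow> (complex \<Rightarrow> 'b) \<Rightarrow> bool" where
  "mutually_locally_derivable A B \<longleftrightarrow>
    locally_derivable_from B A \<and> locally_derivable_from A B"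

end

theory Submission
  imports Defs
begin

text \<open>That the tiling determines its parity locally is trivial, since the parity of a tile is a function of
the tile. The converse rests on the hierarchy of the tiling. A tile is encoded by its \<^emph>\<open>arrow\<close>, the unit
vector along the stripe that has the stripe on its left, and by its parity. The matching rules then become
two combinatorial conditions on the lattice.

The smallest black triangles sit over three mutually adjacent tiles. Wherever a tile carries a
corner of such a triangle, rule R2 forces another one opposite to it (\<open>inward_opposite\<close>), so one triangle
generates a whole kagome pattern of them, whose complement is a coset \<open>c + 2Q\<close>. The stripe of the tile
at \<open>c + u + 2m\<close>, for a unit vector \<open>u\<close>, is parallel to \<open>u\<close>; this is the predicate \<open>skeleton T c\<close>. Tiles
off the coset transport both matching rules between the tiles on it, so the tiles on \<open>c + 2Q\<close> again form
a Taylor--Socolar tiling, twice as large (\<open>valid_sub\<close>), with its own coset \<open>c' + 2Q\<close>. Moreover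
they determine the arrows off the coset (\<open>skeleton_arrow\<close>). Hence it suffices to read the tiles on a
coset of \<open>4Q\<close> from the parities.

This is possible because a tile \<open>t\<close> at \<open>q = c + 2c' + 4m\<close> is displayed by the parities around it: the
tile at \<open>q + u\<close> is white exactly if the black line of \<open>t\<close> at its edge in direction \<open>u\<close> is displaced
counterclockwise (\<open>white_edge\<close>), and the tile across the vertex between the edges \<open>u\<close> and
\<open>turn u\<close> is white exactly if \<open>t\<close> is red at this vertex (\<open>white_diagonal\<close>). So the 13 parities on and
around \<open>q\<close> are one of twelve patterns, a \<open>patch\<close>.

It remains to locate the coset from the parities. If two tilings have the same parities but different cosets of
\<open>2Q\<close>, then patches of one occur next to patches of the other, in a relative position that is a
unit vector \<open>u\<close> or a diagonal \<open>u + turn u\<close> modulo \<open>4Q\<close>. In the first position two patches never fit together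
(\<open>adjacent_patches\<close>). In the second position they fit only for three values of the arrow, no two of
which are antipodal (\<open>diagonal_patches\<close>), although every tiling contains two antipodal arrows near any of
its points (\<open>antipodal_arrows\<close>). So the coset of \<open>2Q\<close> is determined locally (\<open>skeleton_unique\<close>), and applied to
the tiling on this coset, the same argument determines the coset of \<open>4Q\<close>. All of this inspects a bounded
region only.\<close>

section \<open>Tilings in lattice coordinates\<close>

text \<open>A pair \<open>(a, b)\<close> stands for \<open>a + b * cis (pi / 3)\<close>. In these coordinates the rotation by \<open>pi / 3\<close>
preserves integrality, and equations between lattice points are linear integer arithmetic.\<close>

type_synonym point = "int \<times> int"

definition turn :: "point \<Rightarrow> point" where
  "turn p = (- snd p, fst p + snd p)"

definition units :: "point set" where
  "units = {(1, 0), (0, 1), (- 1, 1), (- 1, 0), (0, - 1), (1, - 1)}"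

text \<open>The parity replaces the side of the red half of the split diagonal, so that a tiling is a pair of an
unknown arrow and a given parity at each point.\<close>

datatype marked = Marked (arrow: point) (white: bool)

text \<open>Each hexagon edge is crossed by one black line, displaced from the edge midpoint either counterclockwise
or clockwise as seen from the tile. At the edge in direction \<open>u\<close> it is displaced counterclockwise
for three of the six directions: the arrow itself and the clockwise neighbors of the two corners at
which the V-shaped lines sit.\<close>

definition ccw :: "marked \<Rightarrow> point \<Rightarrow> bool" where
  "ccw t u \<longleftrightarrow> u \<in> {arrow t, turn (arrow t), - turn (arrow t)}"

text \<open>The color at the vertex between the edges in the directions \<open>u\<close> and \<open>turn u\<close>; the vertices of the split
diagonal are those at \<open>turn j\<close> and \<open>- turn j\<close>, where \<open>j\<close> is the arrow, and the stripe crosses the half at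
\<open>turn j\<close>.\<close>

definition red :: "marked \<Rightarrow> point \<Rightarrow> bool" where
  "red t u \<longleftrightarrow> u \<in> {turn (turn (arrow t)), - turn (turn (arrow t)),
     if white t then turn (arrow t) else - turn (arrow t)}"

text \<open>The edge in direction \<open>u\<close> is shared with the tile at \<open>p + u\<close>, from which it is seen in direction \<open>- u\<close>
and with the opposite orientation. The second condition is rule R2.\<close>

definition valid :: "(point \<Rightarrow> marked) \<Rightarrow> bool" where
  "valid T \<longleftrightarrow> (\<forall>p. arrow (T p) \<in> units) \<and>
     (\<forall>p. \<forall>u\<in>units. ccw (T p) u \<noteq> ccw (T (p + u)) (- u)) \<and>
     (\<forall>p. \<forall>u\<in>units. red (T p) u \<noteq> red (T (p + u + turn u)) (- u))"

lemma valid_arrow: "valid T \<Longrightarrow> arrow (T p) \<in> units"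
  unfolding valid_def by blast

lemma valid_edge: "valid T \<Longrightarrow> u \<in> units \<Longrightarrow> q = p + u \<Longrightarrow> ccw (T p) u \<noteq> ccw (T q) (- u)"
  unfolding valid_def by blast

lemma valid_diagonal:
  "valid T \<Longrightarrow> u \<in> units \<Longrightarrow> q = p + u + turn u \<Longrightarrow> red (T p) u \<noteq> red (T q) (- u)"
  unfolding valid_def by blast

lemma turn_turn: "turn (turn p) = turn p - p"
  by (simp add: turn_def prod_eq_iff)

lemma turn_minus: "turn (- p) = - turn p"
  by (simp add: turn_def)

lemma turn_units: "u \<in> units \<Longrightarrow> turn u \<in> units"
  by (auto simp: units_def turn_def)

lemma minus_units: "u \<in> units \<Longrightarrow> - u \<in> units"
  by (auto simp: units_def)

lemma turn_turn_units: "u \<in> units \<Longrightarrow> turn u - u \<in> units"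
  using turn_units[OF turn_units] by (simp add: turn_turn)

lemmas unit_closed = turn_units minus_units turn_turn_units

section \<open>Smallest triangles\<close>

lemma unitsE:
  assumes "u \<in> units"
  obtains "u = (1, 0)" | "u = (0, 1)" | "u = (- 1, 1)" | "u = (- 1, 0)" | "u = (0, - 1)" | "u = (1, - 1)"
  using assms by (auto simp: units_def)

text \<open>The three black lines that cross the hexagon edges between the tiles at \<open>p\<close>, \<open>p + u\<close> and \<open>p + turn u\<close> are
all displaced towards the common vertex of these hexagons: they form a smallest black triangle.\<close>

definition inward :: "(point \<Rightarrow> marked) \<Rightarrow> point \<Rightarrow> point \<Rightarrow> bool" where
  "inward T p u \<longleftrightarrow> ccw (T p) u \<and> \<not> ccw (T p) (turn u) \<and> ccw (T (p + u)) (turn u - u)"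

text \<open>The following facts run through the six possible arrows. A tile carries corners of black triangles at the
vertices \<open>turn j\<close> and \<open>- turn j\<close> for its arrow \<open>j\<close>, and at two of the other four vertices the black lines
nearby are displaced in the same rotational sense.\<close>

lemma corner_arrow:
  assumes "u \<in> units" "arrow t \<in> units" "ccw t u" "\<not> ccw t (turn u)"
  shows "arrow t = turn u - u \<or> arrow t = u - turn u"
  by (rule unitsE[OF assms(1)]; rule unitsE[OF assms(2)]; insert assms(3,4); simp add: turn_def ccw_def)

lemma both_ccw_arrow:
  assumes "u \<in> units" "arrow t \<in> units" "ccw t u" "ccw t (turn u)"
  shows "arrow t = u"
  by (rule unitsE[OF assms(1)]; rule unitsE[OF assms(2)]; insert assms(3,4); simp add: turn_def ccw_def)

lemma both_cw_arrow:
  assumes "u \<in> units" "arrow t \<in> units" "\<not> ccw t u" "\<not> ccw t (turn u)"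
  shows "arrow t = - turn u"
  by (rule unitsE[OF assms(1)]; rule unitsE[OF assms(2)]; insert assms(3,4); simp add: turn_def ccw_def)

lemma corner_opposite:
  assumes "u \<in> units" "arrow t \<in> units" "ccw t u" "\<not> ccw t (turn u)"
  shows "ccw t (- u) \<and> \<not> ccw t (- turn u)"
  by (rule unitsE[OF assms(1)]; rule unitsE[OF assms(2)]; insert assms(3,4); simp add: turn_def ccw_def)

lemma diagonal_not_red:
  assumes "u \<in> units" "arrow t = u \<or> arrow t = - u"
  shows "\<not> red t u \<and> \<not> red t (- u)"
  by (rule unitsE[OF assms(1)]; rule disjE[OF assms(2)]; simp add: turn_def red_def)

lemma arrow_corner:
  assumes "arrow t \<in> units"
  shows "ccw t (turn (arrow t)) \<and> \<not> ccw t (turn (turn (arrow t)))"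
  by (rule unitsE[OF assms]; simp add: turn_def ccw_def)

lemma inward_rotate:
  assumes T: "valid T" and u: "u \<in> units" and "inward T p u"
  shows "inward T (p + u) (turn u - u)"
proof -
  have 1: "ccw (T p) u" "\<not> ccw (T p) (turn u)" "ccw (T (p + u)) (turn u - u)"
    using assms by (auto simp: inward_def)
  have "ccw (T p) u \<noteq> ccw (T (p + u)) (- u)"
    by (rule valid_edge[OF T u]) simp
  moreover have "ccw (T p) (turn u) \<noteq> ccw (T (p + turn u)) (- turn u)"
    by (rule valid_edge[OF T turn_units[OF u]]) simp
  moreover have "turn (turn u - u) = - u" "turn (turn u - u) - (turn u - u) = - turn u"
     "p + u + (turn u - u) = p + turn u"
    by (auto simp: turn_def prod_eq_iff)
  ultimately show ?thesis
    using 1 by (simp add: inward_def)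
qed

text \<open>A corner that does not belong to a smallest triangle leaves the two neighboring tiles no freedom: one of
their edges is crossed towards the common vertex and one away from it.\<close>

lemma corner_not_inward:
  assumes T: "valid T" and no: "\<not> inward T p (turn (arrow (T p)))"
  defines "u \<equiv> turn (arrow (T p))"
  shows "arrow (T (p + u)) = u" and "arrow (T (p + turn u)) = - turn u"
proof -
  define j where "j = arrow (T p)"
  have j: "j \<in> units"
    using T by (simp add: j_def valid_arrow)
  have u: "u = turn j" "u \<in> units" "turn u = u - j" "turn u \<in> units"
    using j by (auto simp: u_def j_def unit_closed turn_turn)
  have c: "ccw (T p) u" "\<not> ccw (T p) (turn u)"
    using arrow_corner[OF j[unfolded j_def]] by (simp_all add: u(1) j_def)
  have a: "\<not> ccw (T (p + u)) (- j)"
    using no c u(3) by (simp add: inward_def u_def[symmetric])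
  have b: "\<not> ccw (T (p + u)) (- u)"
    using valid_edge[OF T u(2), of "p + u" p] c by simp
  show "arrow (T (p + u)) = u"
    using both_cw_arrow[of "- j" "T (p + u)"] a b j T u(1)
    by (simp add: turn_minus unit_closed valid_arrow)
  have "ccw (T (p + turn u)) j"
    using valid_edge[OF T minus_units[OF j], of "p + turn u" "p + u"] a u(3) by simp
  moreover have "ccw (T (p + turn u)) (- turn u)"
    using valid_edge[OF T u(4), of "p + turn u" p] c by simp
  moreover have "turn (- turn u) = j"
    by (simp add: u(1) turn_def prod_eq_iff)
  ultimately show "arrow (T (p + turn u)) = - turn u"
    using both_ccw_arrow[of "- turn u" "T (p + turn u)"] u(4) T
    by (simp add: unit_closed valid_arrow)
qed

text \<open>If no smallest triangle existed, the previous lemma could be applied at a tile and then at one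
of its neighbors, and would give the same third tile two different arrows.\<close>

lemma inward_exists:
  assumes T: "valid T"
  shows "\<exists>p u. u \<in> units \<and> inward T p u"
proof (rule ccontr)
  assume none: "\<not> ?thesis"
  define j where "j = arrow (T 0)"
  define u where "u = turn j"
  have j: "j \<in> units"
    using T by (simp add: j_def valid_arrow)
  have no: "\<not> inward T p (turn (arrow (T p)))" for p
    using none valid_arrow[OF T] turn_units by blast
  have *: "arrow (T u) = u" "arrow (T (turn u)) = - turn u"
    using corner_not_inward[OF T no, of 0] by (simp_all add: u_def j_def)
  have "arrow (T (u + turn (turn u))) = - turn (turn u)"
    using corner_not_inward(2)[OF T no, of u] * by simp
  then have "- turn (turn u) = - turn u"
    using * by (simp add: turn_turn)
  with j show False
    by (auto simp: u_def turn_def units_def)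
qed

lemma inward_rotate_twice:
  assumes T: "valid T" and u: "u \<in> units" and i: "inward T p u"
  shows "inward T (p + turn u) (- turn u)"
proof -
  have *: "p + u + (turn u - u) = p + turn u" "turn (turn u - u) - (turn u - u) = - turn u"
    by (simp_all add: turn_def prod_eq_iff)
  show ?thesis
    using inward_rotate[OF T turn_turn_units[OF u] inward_rotate[OF T u i]] unfolding * .
qed

text \<open>The tile at \<open>p\<close> carries a corner opposite to its corner of the given triangle. If the triangle there
were not complete, the tile at \<open>p - u\<close> would have an arrow along \<open>u\<close>, as has the tile at \<open>p + turn u\<close>. These
two tiles face each other across a diagonal, and both would be blue at its ends, against R2.\<close>

lemma inward_opposite:
  assumes T: "valid T" and u: "u \<in> units" and i: "inward T p u"
  shows "inward T p (- u)"
proof (rule ccontr)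
  assume no: "\<not> inward T p (- u)"
  have c: "ccw (T p) (- u)" "\<not> ccw (T p) (- turn u)"
    using i u valid_arrow[OF T, of p] corner_opposite[of u "T p"] unfolding inward_def
    by auto
  have "\<not> ccw (T (p - u)) (u - turn u)"
    using no c by (simp add: inward_def turn_minus)
  moreover have "\<not> ccw (T (p - u)) u"
    using valid_edge[OF T minus_units[OF u], of "p - u" p] c by simp
  moreover have eq: "turn (u - turn u) = u" "- (turn u - u) = u - turn u"
    by (simp_all add: turn_def prod_eq_iff)
  ultimately have 1: "arrow (T (p - u)) = - u"
    using both_cw_arrow[of "u - turn u" "T (p - u)"] valid_arrow[OF T]
      minus_units[OF turn_turn_units[OF u]] by (simp add: eq)
  have "inward T (p + turn u) (- turn u)"
    by (rule inward_rotate_twice[OF T u i])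
  then have 2: "arrow (T (p + turn u)) = u \<or> arrow (T (p + turn u)) = - u"
    using corner_arrow[of "- turn u" "T (p + turn u)"] u T
    by (auto simp add: inward_def unit_closed valid_arrow turn_minus turn_turn)
  have "red (T (p + turn u)) (- u) \<noteq> red (T (p - u)) u"
    using valid_diagonal[OF T minus_units[OF u], of "p - u" "p + turn u"]
    by (simp add: turn_minus)
  with diagonal_not_red[OF u, of "T (p - u)"] diagonal_not_red[OF u, of "T (p + turn u)"] 1 2
  show False
    by blast
qed

text \<open>Passing from a triangle to the one opposite to it at a vertex, and from there to the one opposite at another
vertex, moves it by twice a lattice vector. Thus one triangle spreads over a coset of \<open>2Q\<close>.\<close>

lemma inward_shift_neg:
  assumes T: "valid T" and u: "u \<in> units" and i: "inward T p u"
  shows "inward T (p - (u + u)) u" and "inward T (p - (turn u + turn u)) u"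
proof -
  have "inward T (p - u) (u - turn u)"
    using inward_rotate[OF T minus_units[OF u] inward_opposite[OF T u i]]
    by (simp add: turn_minus)
  then have "inward T (p - u) (turn u - u)"
    using inward_opposite[OF T minus_units[OF turn_turn_units[OF u]], of "p - u"] by simp
  then have *: "inward T (p - u + turn (turn u - u)) (- turn (turn u - u))"
    by (rule inward_rotate_twice[OF T turn_turn_units[OF u]])
  have eq: "p - u + turn (turn u - u) = p - (u + u)" "- turn (turn u - u) = u"
    by (simp_all add: turn_def prod_eq_iff)
  show "inward T (p - (u + u)) u"
    using * unfolding eq .
  have "inward T (p - turn u) (turn u)"
    using inward_rotate_twice[OF T minus_units[OF u] inward_opposite[OF T u i]]
    by (simp add: turn_minus)
  then have "inward T (p - turn u) (- turn u)"
    by (rule inward_opposite[OF T turn_units[OF u]])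
  then have *: "inward T (p - turn u + - turn u) (turn (- turn u) - - turn u)"
    by (rule inward_rotate[OF T minus_units[OF turn_units[OF u]]])
  have eq: "p - turn u + - turn u = p - (turn u + turn u)" "turn (- turn u) - - turn u = u"
    by (simp_all add: turn_def prod_eq_iff)
  show "inward T (p - (turn u + turn u)) u"
    using * unfolding eq .
qed

lemma inward_shift_pos:
  assumes T: "valid T" and u: "u \<in> units" and i: "inward T p u"
  shows "inward T (p + (u + u)) u" and "inward T (p + (turn u + turn u)) u"
proof -
  have eq: "p - (- u + - u) = p + (u + u)" "p - (turn (- u) + turn (- u)) = p + (turn u + turn u)"
    by (simp_all add: turn_def prod_eq_iff)
  show "inward T (p + (u + u)) u" "inward T (p + (turn u + turn u)) u"
    using inward_shift_neg[OF T minus_units[OF u] inward_opposite[OF T u i],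
        THEN inward_opposite[OF T minus_units[OF u]]] unfolding eq by simp_all
qed

lemma units_cases:
  assumes "u \<in> units" "v \<in> units"
  shows "v = u \<or> v = - u \<or> v = turn u \<or> v = - turn u \<or> v = turn u - u \<or> v = u - turn u"
  by (rule unitsE[OF assms(1)]; rule unitsE[OF assms(2)]; simp add: turn_def)

lemma inward_shift_unit:
  assumes T: "valid T" and u: "u \<in> units" and v: "v \<in> units" and i: "inward T p u"
  shows "inward T (p + (v + v)) u"
proof -
  have eq: "p + (u + u) - (turn u + turn u) = p + ((u - turn u) + (u - turn u))"
    "p + (- u + - u) + (turn u + turn u) = p + ((turn u - u) + (turn u - u))"
    "p - (u + u) = p + (- u + - u)" "p - (turn u + turn u) = p + (- turn u + - turn u)"
    by (simp_all add: prod_eq_iff)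
  have "inward T (p + ((u - turn u) + (u - turn u))) u"
    using inward_shift_neg(2)[OF T u inward_shift_pos(1)[OF T u i]] unfolding eq .
  moreover have "inward T (p + ((turn u - u) + (turn u - u))) u"
    using inward_shift_pos(2)[OF T u inward_shift_neg(1)[OF T u i]] unfolding eq .
  ultimately show ?thesis
    using units_cases[OF u v] inward_shift_pos[OF T u i] inward_shift_neg[OF T u i, unfolded eq]
    by blast
qed

lemma inward_everywhere:
  assumes T: "valid T" and u: "u \<in> units" and i: "inward T p u"
  shows "inward T (p + (m + m)) u"
proof -
  note step = inward_shift_unit[OF T u]
  have row: "inward T (q + (2 * a, 0)) u" if "inward T q u" for q a
  proof (induction a rule: int_induct[of _ 0])
    case base
    then show ?case using that by (simp add: zero_prod_def[symmetric])
  next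
    case (step1 a)
    have "q + (2 * a, 0) + ((1, 0) + (1, 0)) = q + (2 * (a + 1), 0)"
      by (simp add: prod_eq_iff)
    then show ?case using step[of "(1, 0)", OF _ step1(2)] unfolding units_def by (simp only:) blast
  next
    case (step2 a)
    have "q + (2 * a, 0) + ((- 1, 0) + (- 1, 0)) = q + (2 * (a - 1), 0)"
      by (simp add: prod_eq_iff)
    then show ?case using step[of "(- 1, 0)", OF _ step2(2)] unfolding units_def by (simp only:) blast
  qed
  have column: "inward T (q + (0, 2 * a)) u" if "inward T q u" for q a
  proof (induction a rule: int_induct[of _ 0])
    case base
    then show ?case using that by (simp add: zero_prod_def[symmetric])
  next
    case (step1 a)
    have "q + (0, 2 * a) + ((0, 1) + (0, 1)) = q + (0, 2 * (a + 1))"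
      by (simp add: prod_eq_iff)
    then show ?case using step[of "(0, 1)", OF _ step1(2)] unfolding units_def by (simp only:) blast
  next
    case (step2 a)
    have "q + (0, 2 * a) + ((0, - 1) + (0, - 1)) = q + (0, 2 * (a - 1))"
      by (simp add: prod_eq_iff)
    then show ?case using step[of "(0, - 1)", OF _ step2(2)] unfolding units_def by (simp only:) blast
  qed
  have eq: "p + (2 * fst m, 0) + (0, 2 * snd m) = p + (m + m)"
    by (simp add: prod_eq_iff)
  show ?thesis
    using column[OF row[OF i, of "fst m"], of "snd m"] unfolding eq .
qed

section \<open>The coset of the next larger tiling\<close>

definition skeleton :: "(point \<Rightarrow> marked) \<Rightarrow> point \<Rightarrow> bool" where
  "skeleton T c \<longleftrightarrow>
    (\<forall>u\<in>units. \<forall>m. arrow (T (c + u + (m + m))) = u \<or> arrow (T (c + u + (m + m))) = - u)"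

lemma skeletonD:
  "skeleton T c \<Longrightarrow> u \<in> units \<Longrightarrow> q = c + u + (m + m) \<Longrightarrow> arrow (T q) = u \<or> arrow (T q) = - u"
  unfolding skeleton_def by blast

lemma inward_arrow:
  assumes T: "valid T" and u: "u \<in> units" and i: "inward T p u"
  shows "arrow (T p) = turn u - u \<or> arrow (T p) = u - turn u"
  using i corner_arrow[OF u valid_arrow[OF T], of p] by (simp add: inward_def)

text \<open>Each vertex of the kagome pattern belongs to a smallest triangle, whose corner there fixes the
direction of the stripe. If \<open>p\<close>, \<open>p + u\<close>, \<open>p + turn u\<close> is one of these triangles,
then \<open>p + u + turn u\<close> represents the only class modulo \<open>2Q\<close> without vertices of the pattern.\<close>

lemma skeleton_exists:
  assumes T: "valid T"
  shows "\<exists>c. fst c \<in> {0, 1} \<and> snd c \<in> {0, 1} \<and> skeleton T c"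
proof -
  obtain p u where u: "u \<in> units" and i: "inward T p u"
    using inward_exists[OF T] by blast
  define c0 where "c0 = p + u + turn u"
  have sk: "arrow (T (c0 + v + (m + m))) = v \<or> arrow (T (c0 + v + (m + m))) = - v"
    if v: "v \<in> units" for v m
  proof -
    have 1: "arrow (T (p + (n + n))) \<in> {turn u - u, - (turn u - u)}" for n
      using inward_arrow[OF T u inward_everywhere[OF T u i]] by (simp only: minus_diff_eq) blast
    have e2: "turn (turn u - u) = - u"
      by (simp add: turn_def prod_eq_iff)
    have 2: "arrow (T (p + u + (n + n))) \<in> {turn u, - turn u}" for n
      using inward_arrow[OF T turn_turn_units[OF u]
          inward_everywhere[OF T turn_turn_units[OF u] inward_rotate[OF T u i]], of n]
      unfolding e2 by (auto simp: algebra_simps)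
    have e3: "turn (- turn u) - (- turn u) = u" "- turn u - turn (- turn u) = - u"
      by (simp_all add: turn_def prod_eq_iff)
    have 3: "arrow (T (p + turn u + (n + n))) \<in> {u, - u}" for n
      using inward_arrow[OF T minus_units[OF turn_units[OF u]]
          inward_everywhere[OF T minus_units[OF turn_units[OF u]] inward_rotate_twice[OF T u i]], of n]
      unfolding e3 by blast
    consider "v = u" | "v = - u" | "v = turn u" | "v = - turn u" | "v = turn u - u" | "v = u - turn u"
      using units_cases[OF u v] by blast
    then show ?thesis
    proof cases
      case 1
      have eq: "c0 + u + (m + m) = p + turn u + ((m + u) + (m + u))"
        by (simp add: c0_def prod_eq_iff)
      show ?thesis using 3[of "m + u"] unfolding 1 eq by auto
    next
      case 2
      have eq: "c0 + - u + (m + m) = p + turn u + (m + m)"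
        by (simp add: c0_def prod_eq_iff)
      show ?thesis using 3[of m] unfolding 2 eq by auto
    next
      case 3
      have eq: "c0 + turn u + (m + m) = p + u + ((m + turn u) + (m + turn u))"
        by (simp add: c0_def prod_eq_iff)
      show ?thesis using 2[of "m + turn u"] unfolding 3 eq by auto
    next
      case 4
      have eq: "c0 + - turn u + (m + m) = p + u + (m + m)"
        by (simp add: c0_def prod_eq_iff)
      show ?thesis using 2[of m] unfolding 4 eq by auto
    next
      case 5
      have eq: "c0 + (turn u - u) + (m + m) = p + ((m + turn u) + (m + turn u))"
        by (simp add: c0_def prod_eq_iff)
      show ?thesis using 1[of "m + turn u"] unfolding 5 eq by auto
    next
      case 6
      have eq: "c0 + (u - turn u) + (m + m) = p + ((m + u) + (m + u))"
        by (simp add: c0_def prod_eq_iff)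
      show ?thesis using 1[of "m + u"] unfolding 6 eq by auto
    qed
  qed
  define c where "c = (fst c0 mod 2, snd c0 mod 2)"
  define n where "n = (fst c0 div 2, snd c0 div 2)"
  have "c + u + (m + m) = c0 + u + ((m - n) + (m - n))" for u m
    by (simp add: c_def n_def prod_eq_iff minus_mult_div_eq_mod[symmetric])
  then have eq: "c + u + (m + m) = c0 + u + ((m - n) + (m - n))" for u m .
  have "skeleton T c"
    unfolding skeleton_def eq using sk by blast
  moreover have "fst c \<in> {0, 1}" "snd c \<in> {0, 1}"
    by (auto simp: c_def)
  ultimately show ?thesis by blast
qed

text \<open>The tiles on the coset \<open>c + 2Q\<close>, scaled back to the whole lattice.\<close>

definition sub :: "(point \<Rightarrow> marked) \<Rightarrow> point \<Rightarrow> point \<Rightarrow> marked" where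
  "sub T c m = T (c + (m + m))"

lemma ccw_opposite:
  assumes "u \<in> units" "arrow t = u \<or> arrow t = - u"
  shows "ccw t u \<noteq> ccw t (- u)"
  by (rule unitsE[OF assms(1)]; rule disjE[OF assms(2)]; simp add: turn_def ccw_def)

lemma red_opposite:
  assumes "u \<in> units" "arrow t = turn u - u \<or> arrow t = - (turn u - u)"
  shows "red t u \<noteq> red t (- u)"
  by (rule unitsE[OF assms(1)]; rule disjE[OF assms(2)]; simp add: turn_def red_def)

text \<open>Between the tiles at \<open>p\<close> and \<open>p + 2u\<close> of the coset lies a tile whose stripe runs from one to the other
and crosses both edges with the same displacement; between the tiles at \<open>p\<close> and
\<open>p + 2(u + turn u)\<close> lies one whose split diagonal connects them and exchanges red and blue. So the
middle tile passes each rule on to the tiles of the coset.\<close>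

lemma valid_sub:
  assumes T: "valid T" and S: "skeleton T c"
  shows "valid (sub T c)"
proof -
  have "ccw (sub T c p) u \<noteq> ccw (sub T c (p + u)) (- u)" if u: "u \<in> units" for p u
  proof -
    define x where "x = c + (p + p) + u"
    have "arrow (T x) = u \<or> arrow (T x) = - u"
      by (rule skeletonD[OF S u, of _ p]) (simp add: x_def prod_eq_iff)
    moreover have "ccw (T (c + (p + p))) u \<noteq> ccw (T x) (- u)"
      by (rule valid_edge[OF T u]) (simp add: x_def)
    moreover have "ccw (T x) u \<noteq> ccw (T (c + ((p + u) + (p + u)))) (- u)"
      by (rule valid_edge[OF T u]) (simp add: x_def prod_eq_iff)
    ultimately show ?thesis
      using ccw_opposite[OF u, of "T x"] by (auto simp: sub_def)
  qed
  moreover have "red (sub T c p) u \<noteq> red (sub T c (p + u + turn u)) (- u)" if u: "u \<in> units" for p u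
  proof -
    define x where "x = c + (p + p) + u + turn u"
    have "arrow (T x) = turn u - u \<or> arrow (T x) = - (turn u - u)"
      by (rule skeletonD[OF S turn_turn_units[OF u], of _ "p + u"]) (simp add: x_def prod_eq_iff)
    moreover have "red (T (c + (p + p))) u \<noteq> red (T x) (- u)"
      by (rule valid_diagonal[OF T u]) (simp add: x_def)
    moreover have "red (T x) u \<noteq> red (T (c + ((p + u + turn u) + (p + u + turn u)))) (- u)"
      by (rule valid_diagonal[OF T u]) (simp add: x_def prod_eq_iff)
    ultimately show ?thesis
      using red_opposite[OF u, of "T x"] by (auto simp: sub_def)
  qed
  ultimately show ?thesis
    unfolding valid_def using valid_arrow[OF T] by (simp add: sub_def del: split_paired_All)
qed

text \<open>The stripe of a tile off the coset is along a known line, and the black line of the neighboring tile of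
the coset tells on which side it is.\<close>

lemma skeleton_arrow:
  assumes T: "valid T" and S: "skeleton T c" and u: "u \<in> units" and p: "p = c + (m + m)"
  shows "arrow (T (p + u)) = (if ccw (T p) u then u else - u)"
proof -
  have "arrow (T (p + u)) = u \<or> arrow (T (p + u)) = - u"
    by (rule skeletonD[OF S u, of _ m]) (simp add: p prod_eq_iff)
  moreover have "ccw (T p) u \<noteq> ccw (T (p + u)) (- u)"
    by (rule valid_edge[OF T u]) simp
  moreover have "ccw t (- u) \<longleftrightarrow> arrow t = - u" if "arrow t = u \<or> arrow t = - u" for t
    by (rule unitsE[OF u]; rule disjE[OF that]; simp add: turn_def ccw_def)
  moreover have "u \<noteq> - u"
    using u by (rule unitsE) simp_all
  ultimately show ?thesis
    by auto
qed

section \<open>Parities around a tile of the second level\<close>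

text \<open>The stripe of the tile at \<open>q + u\<close> continues the black line of the tile at \<open>q\<close>. The end of its split
diagonal at \<open>turn u\<close> faces the tile at \<open>q + 2 turn u\<close>, which has a stripe along \<open>turn u\<close> since it is off
the coset of the second level, hence a blue end there. So this end is red, and only the side of
the stripe decides the parity.\<close>

lemma white_edge:
  assumes T: "valid T" and S: "skeleton T c" and S': "skeleton (sub T c) c'" and u: "u \<in> units"
    and q: "q = c + ((c' + (m + m)) + (c' + (m + m)))"
  shows "white (T (q + u)) \<longleftrightarrow> ccw (T q) u"
proof -
  define y where "y = q + (turn u + turn u)"
  have "arrow (sub T c (c' + turn u + (m + m))) = turn u \<or> arrow (sub T c (c' + turn u + (m + m))) = - turn u"
    by (rule skeletonD[OF S' turn_units[OF u]]) simp
  moreover have eq: "sub T c (c' + turn u + (m + m)) = T y"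
    by (simp add: sub_def y_def q) (simp add: algebra_simps)
  ultimately have y: "\<not> red (T y) (- turn u)"
    using diagonal_not_red[OF turn_units[OF u]] by auto
  have "red (T (q + u)) (turn u) \<noteq> red (T y) (- turn u)"
    by (rule valid_diagonal[OF T turn_units[OF u]]) (simp add: y_def turn_turn)
  with y have "red (T (q + u)) (turn u)"
    by blast
  moreover have "arrow (T (q + u)) = (if ccw (T q) u then u else - u)"
    by (rule skeleton_arrow[OF T S u q])
  moreover have "red t (turn u) \<Longrightarrow> arrow t = u \<Longrightarrow> white t"
    "red t (turn u) \<Longrightarrow> arrow t = - u \<Longrightarrow> \<not> white t" for t
    by (rule unitsE[OF u]; simp add: turn_def red_def split: if_splits)+
  ultimately show ?thesis
    by (auto split: if_splits)
qed

text \<open>Here the stripe is fixed and the split diagonal varies: the stripe of this tile continues a black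
line of the tile at \<open>q + 2u\<close>, which is off the coset of the second level and has a stripe along \<open>u\<close>, and its
split diagonal faces the vertex \<open>u\<close> of the tile at \<open>q\<close>.\<close>

lemma white_diagonal:
  assumes T: "valid T" and S: "skeleton T c" and S': "skeleton (sub T c) c'" and u: "u \<in> units"
    and q: "q = c + ((c' + (m + m)) + (c' + (m + m)))"
  shows "white (T (q + u + turn u)) \<longleftrightarrow> red (T q) u"
proof -
  define n where "n = c' + u + (m + m)"
  define v where "v = turn u - u"
  have v: "v \<in> units"
    using turn_turn_units[OF u] by (simp add: v_def)
  have "arrow (sub T c n) = u \<or> arrow (sub T c n) = - u"
    by (rule skeletonD[OF S' u]) (simp add: n_def)
  moreover have "arrow t = u \<or> arrow t = - u \<Longrightarrow> \<not> ccw t v" for t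
    unfolding v_def by (rule unitsE[OF u]; elim disjE; simp add: turn_def ccw_def)
  ultimately have "\<not> ccw (T (c + (n + n))) v"
    by (simp add: sub_def)
  then have "arrow (T (c + (n + n) + v)) = - v"
    using skeleton_arrow[OF T S v, of "c + (n + n)" n] by simp
  moreover have "c + (n + n) + v = q + u + turn u"
    by (simp add: n_def v_def q prod_eq_iff)
  ultimately have "arrow (T (q + u + turn u)) = - v"
    by simp
  moreover have "red (T q) u \<noteq> red (T (q + u + turn u)) (- u)"
    by (rule valid_diagonal[OF T u]) simp
  moreover have "arrow t = - v \<Longrightarrow> red t (- u) \<longleftrightarrow> \<not> white t" for t
    unfolding v_def by (rule unitsE[OF u]; simp add: turn_def red_def)
  ultimately show ?thesis
    by auto
qed

text \<open>The parities \<open>f\<close> around \<open>q\<close> are those that a tile \<open>t\<close> of the second level at \<open>q\<close> enforces.\<close>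

definition patch :: "(point \<Rightarrow> bool) \<Rightarrow> point \<Rightarrow> marked \<Rightarrow> bool" where
  "patch f q t \<longleftrightarrow> f q = white t \<and>
    (\<forall>u\<in>units. f (q + u) = ccw t u \<and> f (q + u + turn u) = red t u)"

lemma patchD:
  assumes "patch f q t"
  shows "f q = white t" "u \<in> units \<Longrightarrow> x = q + u \<Longrightarrow> f x = ccw t u"
    "u \<in> units \<Longrightarrow> x = q + u + turn u \<Longrightarrow> f x = red t u"
  using assms unfolding patch_def by blast+

lemma patch_tiling:
  assumes T: "valid T" and S: "skeleton T c" and S': "skeleton (sub T c) c'"
    and q: "q = c + ((c' + (m + m)) + (c' + (m + m)))"
  shows "patch (\<lambda>x. white (T x)) q (T q)"
  unfolding patch_def using white_edge[OF T S S' _ q] white_diagonal[OF T S S' _ q] by blast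

lemma patch_determines:
  assumes "patch f q t" "patch f q t'" "arrow t \<in> units" "arrow t' \<in> units"
  shows "t = t'"
proof (rule marked.expand, intro conjI)
  show "white t = white t'"
    using assms by (simp add: patchD(1)[symmetric])
  have "\<forall>u\<in>units. ccw t u = ccw t' u"
    using patchD(2)[OF assms(1)] patchD(2)[OF assms(2)] by blast
  then show "arrow t = arrow t'"
    by - (rule unitsE[OF assms(3)]; rule unitsE[OF assms(4)]; simp add: units_def ccw_def turn_def)
qed

text \<open>Two patches whose centers are adjacent share eight points, and no two patterns, equal or different,
agree on all of these.\<close>

lemma adjacent_patches:
  assumes u: "u \<in> units" and t: "arrow t \<in> units" "patch f q t"
    and t': "arrow t' \<in> units" "patch f (q + u) t'"
  shows False
proof -
  note units = u unit_closed[OF u] minus_units[OF turn_units[OF u]] minus_units[OF turn_turn_units[OF u]]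
  have "white t' = ccw t u"
    using patchD(1)[OF t'(2)] patchD(2)[OF t(2) u, of "q + u"] by simp
  moreover have "white t = ccw t' (- u)"
    using patchD(1)[OF t(2)] patchD(2)[OF t'(2) units(3), of q] by simp
  moreover have "ccw t (turn u) = ccw t' (turn u - u)"
    using patchD(2)[OF t(2) units(2), of "q + turn u"] patchD(2)[OF t'(2) units(4), of "q + turn u"]
    by simp
  moreover have "ccw t (- (turn u - u)) = ccw t' (- turn u)"
    using patchD(2)[OF t(2) units(6), of "q + u - turn u"]
      patchD(2)[OF t'(2) units(5), of "q + u - turn u"] by (simp add: algebra_simps)
  moreover have "red t u = ccw t' (turn u)"
    using patchD(3)[OF t(2) units(1), of "q + u + turn u"]
      patchD(2)[OF t'(2) units(2), of "q + u + turn u"] by simp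
  moreover have "red t (- (turn u - u)) = ccw t' (- (turn u - u))"
    using patchD(3)[OF t(2) units(6), of "q + u - (turn u - u)"]
      patchD(2)[OF t'(2) units(6), of "q + u - (turn u - u)"]
    by (simp add: turn_def prod_eq_iff)
  moreover have "red t' (- u) = ccw t (- turn u)"
    using patchD(3)[OF t'(2) units(3), of "q - turn u"]
      patchD(2)[OF t(2) units(5), of "q - turn u"] by (simp add: turn_minus)
  moreover have "red t' (turn u - u) = ccw t (turn u - u)"
    using patchD(3)[OF t'(2) units(4), of "q + (turn u - u)"]
      patchD(2)[OF t(2) units(4), of "q + (turn u - u)"] by (simp add: turn_def prod_eq_iff)
  ultimately show False
    by - (rule unitsE[OF u]; rule unitsE[OF t(1)]; rule unitsE[OF t'(1)];
      simp add: turn_def ccw_def red_def split: if_splits)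
qed

text \<open>In this relative position six common points leave four combinations of tiles, in which three arrows
occur.\<close>

lemma diagonal_patches:
  assumes u: "u \<in> units" and t: "arrow t \<in> units" "patch f q t"
    and t': "arrow t' \<in> units" "patch f (q + u + turn u) t'"
  shows "arrow t \<in> {turn u, turn u - u, - u}"
proof -
  note units = u unit_closed[OF u] minus_units[OF turn_units[OF u]] minus_units[OF turn_turn_units[OF u]]
  have "white t' = red t u"
    using patchD(1)[OF t'(2)] patchD(3)[OF t(2) u, of "q + u + turn u"] by simp
  moreover have "white t = red t' (- u)"
    using patchD(1)[OF t(2)] patchD(3)[OF t'(2) units(3), of q] by (simp add: turn_minus)
  moreover have "ccw t u = ccw t' (- turn u)"
    using patchD(2)[OF t(2) units(1), of "q + u"] patchD(2)[OF t'(2) units(5), of "q + u"] by simp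
  moreover have "ccw t (turn u) = ccw t' (- u)"
    using patchD(2)[OF t(2) units(2), of "q + turn u"] patchD(2)[OF t'(2) units(3), of "q + turn u"]
    by simp
  moreover have "red t (turn u) = red t' (turn u - u)"
    using patchD(3)[OF t(2) units(2), of "q + (turn u + turn u - u)"]
      patchD(3)[OF t'(2) units(4), of "q + (turn u + turn u - u)"] by (simp add: turn_def prod_eq_iff)
  moreover have "red t (- (turn u - u)) = red t' (- turn u)"
    using patchD(3)[OF t(2) units(6), of "q + u - (turn u - u)"]
      patchD(3)[OF t'(2) units(5), of "q + u - (turn u - u)"] by (simp add: turn_def prod_eq_iff)
  ultimately show ?thesis
    by - (cases "white t"; cases "white t'"; rule unitsE[OF u]; rule unitsE[OF t(1)];
      rule unitsE[OF t'(1)]; simp add: turn_def ccw_def red_def)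
qed

section \<open>The parities determine the tiling\<close>

text \<open>Around a tile with arrow \<open>j\<close> on the coset \<open>c + 2Q\<close>, the black lines in the opposite directions \<open>turn j\<close> and
\<open>- turn j\<close> are both displaced counterclockwise, and the neighbors there have their arrows along them.\<close>

lemma antipodal_arrows:
  assumes T: "valid T"
  obtains p n where "\<bar>fst p\<bar> \<le> 2" "\<bar>snd p\<bar> \<le> 2" "\<bar>fst n\<bar> \<le> 2" "\<bar>snd n\<bar> \<le> 2"
    "arrow (T n) = - arrow (T p)"
proof -
  obtain c where c: "fst c \<in> {0, 1}" "snd c \<in> {0, 1}" and S: "skeleton T c"
    using skeleton_exists[OF T] by blast
  define u where "u = turn (arrow (T c))"
  have j: "arrow (T c) \<in> units"
    by (rule valid_arrow[OF T])
  then have u: "u \<in> units"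
    by (simp add: u_def turn_units)
  have 0: "c = c + (0 + 0)"
    by simp
  have "ccw (T c) u" "ccw (T c) (- u)"
    by (simp_all add: ccw_def u_def)
  then have "arrow (T (c + u)) = u" "arrow (T (c + - u)) = - u"
    using skeleton_arrow[OF T S u 0] skeleton_arrow[OF T S minus_units[OF u] 0] by simp_all
  moreover have "\<bar>fst u\<bar> \<le> 1" "\<bar>snd u\<bar> \<le> 1"
    using u by (auto simp: units_def)
  ultimately show thesis
    using c by (intro that[of "c + u" "c + - u"]) auto
qed

definition agree :: "int \<Rightarrow> (point \<Rightarrow> marked) \<Rightarrow> (point \<Rightarrow> marked) \<Rightarrow> bool" where
  "agree N A B \<longleftrightarrow>
    (\<forall>p. \<bar>fst p\<bar> \<le> N \<longrightarrow> \<bar>snd p\<bar> \<le> N \<longrightarrow> white (A p) = white (B p))"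

lemma agreeD:
  "agree N A B \<Longrightarrow> \<bar>fst p\<bar> \<le> N \<Longrightarrow> \<bar>snd p\<bar> \<le> N \<Longrightarrow> white (A p) = white (B p)"
  unfolding agree_def by blast

lemma patch_agree:
  assumes "patch (\<lambda>x. white (B x)) q t" and "agree N A B"
    and "\<bar>fst q\<bar> \<le> N - 2" and "\<bar>snd q\<bar> \<le> N - 2"
  shows "patch (\<lambda>x. white (A x)) q t"
proof -
  \<comment> \<open>Diagonal vectors such as \<open>(1, 1)\<close> and \<open>(2, - 1)\<close> have coordinates up to 2.\<close>
  have near: "white (A (q + v)) = white (B (q + v))" if "\<bar>fst v\<bar> \<le> 2" "\<bar>snd v\<bar> \<le> 2" for v
    using assms(3,4) that by (intro agreeD[OF assms(2)]) auto
  have "\<bar>fst u\<bar> \<le> 2" "\<bar>snd u\<bar> \<le> 2" "\<bar>fst (u + turn u)\<bar> \<le> 2" "\<bar>snd (u + turn u)\<bar> \<le> 2"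
    if "u \<in> units" for u
    by (rule unitsE[OF that]; simp add: turn_def)+
  then have "white (A (q + u)) = white (B (q + u))"
    "white (A (q + u + turn u)) = white (B (q + u + turn u))" if "u \<in> units" for u
    using near[of u] near[of "u + turn u"] that unfolding add.assoc by blast+
  moreover have "white (A q) = white (B q)"
    using near[of 0] by simp
  ultimately show ?thesis
    using assms(1) unfolding patch_def by blast
qed

text \<open>The 12 residue classes modulo \<open>4Q\<close> that do not lie in \<open>2Q\<close> are represented by the six unit vectors and
the six diagonals.\<close>

lemma odd_offset:
  fixes d :: point
  assumes "odd (fst d) \<or> odd (snd d)"
  obtains u m where "u \<in> units" "d = u + ((m + m) + (m + m)) \<or> d = u + turn u + ((m + m) + (m + m))"
    "\<bar>4 * fst m\<bar> \<le> \<bar>fst d\<bar> + 2" "\<bar>4 * snd m\<bar> \<le> \<bar>snd d\<bar> + 2"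
proof -
  have mod4: "i mod 4 = 0 \<or> i mod 4 = 1 \<or> i mod 4 = 2 \<or> i mod 4 = 3" for i :: int
    by presburger
  have "\<not> (fst d mod 4 \<in> {0, 2} \<and> snd d mod 4 \<in> {0, 2})"
    using assms by simp presburger
  then have "\<exists>u\<in>units. \<exists>w\<in>{u, u + turn u}. fst d mod 4 = fst w mod 4 \<and> snd d mod 4 = snd w mod 4"
    using mod4[of "fst d"] mod4[of "snd d"] by - (elim disjE; simp add: units_def turn_def)
  then obtain u w where u: "u \<in> units" and w: "w \<in> {u, u + turn u}"
    and "fst d mod 4 = fst w mod 4" "snd d mod 4 = snd w mod 4"
    by blast
  then have "4 dvd fst d - fst w" "4 dvd snd d - snd w"
    by (simp_all add: mod_eq_dvd_iff)
  then obtain a b where ab: "fst d = fst w + 4 * a" "snd d = snd w + 4 * b"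
    by (metis add.commute diff_add_cancel dvd_def)
  have "\<bar>fst w\<bar> \<le> 2" "\<bar>snd w\<bar> \<le> 2"
    using u w by (auto elim!: unitsE simp: turn_def)
  moreover have "d = w + (((a, b) + (a, b)) + ((a, b) + (a, b)))"
    using ab by (simp add: prod_eq_iff)
  ultimately show thesis
    using u w ab by (intro that[of u "(a, b)"]) auto
qed

text \<open>The patches of both tilings near the origin are compared. The relevant patches of \<open>B\<close> are centered within
distance 19 of the origin, coordinatewise, so that parities up to distance 24 suffice.\<close>

lemma skeleton_unique:
  assumes A: "valid A" and B: "valid B" and agr: "agree 24 A B"
    and SA: "skeleton A c" "fst c \<in> {0, 1}" "snd c \<in> {0, 1}"
    and SB: "skeleton B d" "fst d \<in> {0, 1}" "snd d \<in> {0, 1}"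
  shows "c = d"
proof (rule ccontr)
  assume "c \<noteq> d"
  obtain c' where c': "fst c' \<in> {0, 1}" "snd c' \<in> {0, 1}" and SA': "skeleton (sub A c) c'"
    using skeleton_exists[OF valid_sub[OF A SA(1)]] by blast
  obtain d' where d': "fst d' \<in> {0, 1}" "snd d' \<in> {0, 1}" and SB': "skeleton (sub B d) d'"
    using skeleton_exists[OF valid_sub[OF B SB(1)]] by blast
  define q where "q m = c + ((c' + (m + m)) + (c' + (m + m)))" for m
  define r where "r m = d + ((d' + (m + m)) + (d' + (m + m)))" for m
  define f where "f x = white (A x)" for x
  have PA: "patch f (q m) (A (q m))" for m
    unfolding f_def by (rule patch_tiling[OF A SA(1) SA']) (simp add: q_def)
  have PB: "patch f (r m) (B (r m))" if "\<bar>fst m\<bar> \<le> 4" "\<bar>snd m\<bar> \<le> 4" for m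
    unfolding f_def
  proof (rule patch_agree[OF _ agr])
    show "patch (\<lambda>x. white (B x)) (r m) (B (r m))"
      by (rule patch_tiling[OF B SB(1) SB']) (simp add: r_def)
    show "\<bar>fst (r m)\<bar> \<le> 24 - 2" "\<bar>snd (r m)\<bar> \<le> 24 - 2"
      using that d' SB(2,3) by (auto simp: r_def)
  qed
  define e where "e = r 0 - q 0"
  have coords: "fst e = fst d - fst c + 2 * (fst d' - fst c')" "snd e = snd d - snd c + 2 * (snd d' - snd c')"
    by (simp_all add: e_def q_def r_def)
  have small: "\<bar>fst e\<bar> \<le> 3" "\<bar>snd e\<bar> \<le> 3"
    unfolding coords using SA(2,3) SB(2,3) c' d' by simp_all arith+
  have "fst d - fst c \<in> {1, - 1} \<or> snd d - snd c \<in> {1, - 1}"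
    using \<open>c \<noteq> d\<close> SA(2,3) SB(2,3) by (auto simp: prod_eq_iff)
  moreover have "odd i" if "i \<in> {1, - 1}" for i :: int
    using that by auto
  ultimately have "odd (fst d - fst c) \<or> odd (snd d - snd c)"
    by blast
  then have "odd (fst e) \<or> odd (snd e)"
    unfolding coords by simp
  then obtain u m where u: "u \<in> units"
    and e: "e = u + ((m + m) + (m + m)) \<or> e = u + turn u + ((m + m) + (m + m))"
    and "\<bar>4 * fst m\<bar> \<le> \<bar>fst e\<bar> + 2" "\<bar>4 * snd m\<bar> \<le> \<bar>snd e\<bar> + 2"
    by (rule odd_offset)
  with small have m: "\<bar>fst m\<bar> \<le> 1" "\<bar>snd m\<bar> \<le> 1"
    by linarith+
  have r: "r n = q n + e" for n
    by (simp add: e_def q_def r_def prod_eq_iff)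
  show False
  proof (cases "e = u + ((m + m) + (m + m))")
    case True
    have "r 0 = q m + u"
      unfolding r True by (simp add: q_def prod_eq_iff)
    then show False
      using adjacent_patches[OF u valid_arrow[OF A] PA[of m] valid_arrow[OF B]] PB[of 0] by simp
  next
    case False
    with e have e: "e = u + turn u + ((m + m) + (m + m))"
      by blast
    have three: "arrow (A (q n)) \<in> {turn u, turn u - u, - u}"
      if "\<bar>fst n\<bar> \<le> 2" "\<bar>snd n\<bar> \<le> 2" for n
    proof -
      have "r (n - m) = q n + u + turn u"
        unfolding r e by (simp add: q_def prod_eq_iff)
      moreover have "\<bar>fst (n - m)\<bar> \<le> 4" "\<bar>snd (n - m)\<bar> \<le> 4"
        using that m by simp_all
      ultimately have "patch f (q n + u + turn u) (B (r (n - m)))"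
        using PB[of "n - m"] by simp
      then show ?thesis
        by (rule diagonal_patches[OF u valid_arrow[OF A] PA valid_arrow[OF B]])
    qed
    obtain p n where pn: "\<bar>fst p\<bar> \<le> 2" "\<bar>snd p\<bar> \<le> 2" "\<bar>fst n\<bar> \<le> 2" "\<bar>snd n\<bar> \<le> 2"
      "arrow (sub (sub A c) c' n) = - arrow (sub (sub A c) c' p)"
      using antipodal_arrows[OF valid_sub[OF valid_sub[OF A SA(1)] SA']] by blast
    then have "arrow (A (q n)) = - arrow (A (q p))"
      by (simp add: sub_def q_def)
    with three[OF pn(1,2)] three[OF pn(3,4)] u show False
      by (auto elim!: unitsE simp: turn_def)
  qed
qed

text \<open>A given skeleton turns equality on the coset into equality everywhere: off the coset, the arrows
follow from the adjacent tiles of the coset, and the parities are given.\<close>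

lemma skeleton_determines:
  assumes A: "valid A" and B: "valid B" and agr: "agree 2 A B"
    and SA: "skeleton A c" and SB: "skeleton B c" and c: "fst c \<in> {0, 1}" "snd c \<in> {0, 1}"
    and eq: "\<And>m. \<bar>fst m\<bar> \<le> 2 \<Longrightarrow> \<bar>snd m\<bar> \<le> 2 \<Longrightarrow> A (c + (m + m)) = B (c + (m + m))"
    and p: "\<bar>fst p\<bar> \<le> 2" "\<bar>snd p\<bar> \<le> 2"
  shows "A p = B p"
proof -
  define u :: point where "u = (if even (fst (p - c)) then if even (snd (p - c)) then 0 else (0, 1)
    else if even (snd (p - c)) then (1, 0) else (- 1, 1))"
  define m where "m = (fst (p - c - u) div 2, snd (p - c - u) div 2)"
  have "even (fst (p - c - u))" "even (snd (p - c - u))"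
    by (auto simp: u_def)
  then have pm: "p = c + (m + m) + u"
    unfolding m_def prod_eq_iff by simp
  have u: "u = 0 \<or> u \<in> units"
    by (auto simp: u_def units_def)
  then have "\<bar>fst u\<bar> \<le> 1" "\<bar>snd u\<bar> \<le> 1"
    by (auto simp: units_def)
  moreover have "fst p = fst c + 2 * fst m + fst u" "snd p = snd c + 2 * snd m + snd u"
    by (simp_all add: pm)
  ultimately have "\<bar>fst m\<bar> \<le> 2" "\<bar>snd m\<bar> \<le> 2"
    using p c by auto
  then have m: "A (c + (m + m)) = B (c + (m + m))"
    by (rule eq)
  from u show ?thesis
  proof
    assume "u = 0"
    then show ?thesis using m pm by simp
  next
    assume u: "u \<in> units"
    have "arrow (A p) = arrow (B p)"
      using skeleton_arrow[OF A SA u refl, of m] skeleton_arrow[OF B SB u refl, of m] m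
      by (simp add: pm)
    moreover have "white (A p) = white (B p)"
      by (rule agreeD[OF agr p])
    ultimately show ?thesis
      by (simp add: marked.expand)
  qed
qed

lemma agree_mono: "agree N A B \<Longrightarrow> M \<le> N \<Longrightarrow> agree M A B"
  unfolding agree_def by (meson order_trans)

lemma agree_sub:
  assumes "agree (2 * N + 1) A B" "fst c \<in> {0, 1}" "snd c \<in> {0, 1}"
  shows "agree N (sub A c) (sub B c)"
  unfolding agree_def sub_def
proof (intro allI impI)
  fix m :: point
  assume "\<bar>fst m\<bar> \<le> N" "\<bar>snd m\<bar> \<le> N"
  with assms(2,3) show "white (A (c + (m + m))) = white (B (c + (m + m)))"
    by (intro agreeD[OF assms(1)]) auto
qed

text \<open>The coset is determined twice, for the tilings and for their restrictions to the common coset; the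
second time parities up to distance \<open>2 * 24 + 1\<close> are used. The patches then give the tiles of the second level,
and from these the tiles of the first level and finally all tiles near the origin are recovered.\<close>

lemma white_determines:
  assumes A: "valid A" and B: "valid B" and agr: "agree 50 A B"
  shows "A 0 = B 0"
proof -
  obtain c where SA: "skeleton A c" and c: "fst c \<in> {0, 1}" "snd c \<in> {0, 1}"
    using skeleton_exists[OF A] by blast
  have agr24: "agree 24 A B"
    by (rule agree_mono[OF agr]) simp
  have SB: "skeleton B c"
    using skeleton_exists[OF B] skeleton_unique[OF A B agr24 SA c] by blast
  note A1 = valid_sub[OF A SA] and B1 = valid_sub[OF B SB]
  have agr1: "agree 24 (sub A c) (sub B c)"
    by (rule agree_sub[OF agree_mono[OF agr] c]) simp
  obtain c' where SA1: "skeleton (sub A c) c'" and c': "fst c' \<in> {0, 1}" "snd c' \<in> {0, 1}"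
    using skeleton_exists[OF A1] by blast
  have SB1: "skeleton (sub B c) c'"
    using skeleton_exists[OF B1] skeleton_unique[OF A1 B1 agr1 SA1 c'] by blast
  have 1: "sub A c (c' + (m + m)) = sub B c (c' + (m + m))" if m: "\<bar>fst m\<bar> \<le> 2" "\<bar>snd m\<bar> \<le> 2" for m
  proof -
    define q where "q = c + ((c' + (m + m)) + (c' + (m + m)))"
    have "patch (\<lambda>x. white (A x)) q (B q)"
      by (rule patch_agree[OF patch_tiling[OF B SB SB1 q_def] agr]) (use m c c' in \<open>auto simp: q_def\<close>)
    then have "A q = B q"
      using patch_determines[OF patch_tiling[OF A SA SA1 q_def]] valid_arrow[OF A] valid_arrow[OF B]
      by blast
    then show ?thesis
      by (simp add: sub_def q_def)
  qed
  have 2: "sub A c p = sub B c p" if "\<bar>fst p\<bar> \<le> 2" "\<bar>snd p\<bar> \<le> 2" for p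
    by (rule skeleton_determines[OF A1 B1 _ SA1 SB1 c' 1 that])
      (rule agree_mono[OF agr1], simp)
  show ?thesis
    by (rule skeleton_determines[OF A B _ SA SB c])
      (use 2 agree_mono[OF agr] in \<open>auto simp: sub_def\<close>)
qed

section \<open>Lattice coordinates in the plane\<close>

definition emb :: "point \<Rightarrow> complex" where
  "emb p = Complex (of_int (fst p) + of_int (snd p) / 2) (of_int (snd p) * sqrt 3 / 2)"

lemma emb_add: "emb (p + q) = emb p + emb q"
  by (simp add: emb_def complex_eq_iff field_simps)

lemma emb_minus: "emb (- p) = - emb p"
  by (simp add: emb_def complex_eq_iff)

lemma emb_inject: "emb p = emb q \<longleftrightarrow> p = q"
  by (auto simp: emb_def complex_eq_iff prod_eq_iff)

lemma emb_turn: "emb (turn p) = cis (pi / 3) * emb p"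
  by (simp add: emb_def turn_def complex_eq_iff cos_60 sin_60 field_simps)

lemma Q_lattice_eq: "Q_lattice = range emb"
proof -
  have "of_int m * a1 + of_int n * a2 = emb (m - n, n)" for m n
    by (simp add: emb_def a1_def a2_def complex_eq_iff field_simps)
  then have "Q_lattice = {emb (m - n, n) | m n. True}"
    by (simp add: Q_lattice_def)
  also have "\<dots> = range emb"
    by auto (metis add_diff_cancel_right' prod.collapse)
  finally show ?thesis .
qed

lemma adjacent_emb:
  assumes "u \<in> units"
  shows "adjacent x (x + emb u)"
  using assms by (rule unitsE) (simp_all add: adjacent_def emb_def a1_def a2_def complex_eq_iff)

text \<open>The vertex of the hexagon at the origin that lies between its edges in the directions \<open>u\<close> and
\<open>turn u\<close>.\<close>

definition vertex :: "point \<Rightarrow> complex" where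
  "vertex u = (emb u + emb (turn u)) / 3"

lemma vertex_inject: "vertex u = vertex v \<longleftrightarrow> u = v"
  by (auto simp: vertex_def emb_add[symmetric] emb_inject turn_def prod_eq_iff)

lemma vertex_minus: "vertex (- u) = - vertex u"
  by (simp add: vertex_def emb_minus turn_minus diff_divide_distrib add_divide_distrib)

lemma vertex_Omega: "u \<in> units \<Longrightarrow> vertex u \<in> Omega"
  by (erule unitsE)
    (simp_all add: vertex_def Omega_def w1_def w2_def a1_def a2_def emb_def turn_def complex_eq_iff)

text \<open>The inner products and determinants of pairs of unit vectors of the lattice, as real and imaginary
parts.\<close>

lemma unit_products:
  assumes "u \<in> units" "v \<in> units"
  shows "v \<noteq> u \<Longrightarrow> Re (emb v * cnj (emb u)) \<le> 1 / 2"
    and "\<bar>Im (emb v * cnj (emb u))\<bar> < 1"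
    and "emb u * cnj (emb u) = 1"
proof -
  have s: "sqrt 3 * sqrt 3 = 3" "sqrt 3 < 2"
    by (simp_all add: real_less_lsqrt)
  show "v \<noteq> u \<Longrightarrow> Re (emb v * cnj (emb u)) \<le> 1 / 2"
    by (rule unitsE[OF assms(1)]; rule unitsE[OF assms(2)]; simp add: emb_def s)
  show "\<bar>Im (emb v * cnj (emb u))\<bar> < 1"
    by (rule unitsE[OF assms(1)]; rule unitsE[OF assms(2)]; simp add: emb_def s)
  show "emb u * cnj (emb u) = 1"
    by (rule unitsE[OF assms(1)]; simp add: emb_def complex_eq_iff s)
qed

section \<open>The ends of the black lines\<close>

text \<open>The point of the hexagon edge in direction \<open>u\<close> at distance \<open>eps\<close> counterclockwise from its midpoint;
negative values of \<open>eps\<close> displace it clockwise.\<close>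

definition black_end :: "real \<Rightarrow> point \<Rightarrow> complex" where
  "black_end eps u = emb u / 2 + of_real eps * \<i> * emb u"

lemma extreme_point_segment:
  fixes p q z a :: complex
  assumes "z \<in> closed_segment p q" "Re (p * a) \<le> Re (z * a)" "Re (q * a) < Re (z * a)"
  shows "z = p"
proof -
  obtain t where t: "0 \<le> t" "t \<le> 1" "z = (1 - t) *\<^sub>R p + t *\<^sub>R q"
    using assms(1) by (auto simp: closed_segment_def)
  have "Re (z * a) = (1 - t) * Re (p * a) + t * Re (q * a)"
    by (simp add: t(3) algebra_simps)
  then have "t * (Re (z * a) - Re (q * a)) = (1 - t) * (Re (p * a) - Re (z * a))"
    by (simp add: algebra_simps)
  also have "\<dots> \<le> 0"
    using t assms(2) by (simp add: mult_nonneg_nonpos)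
  finally have "t \<le> 0"
    using assms(3) by (simp add: mult_le_0_iff)
  with t show ?thesis by simp
qed


lemma units_nonzero: "u \<in> units \<Longrightarrow> u \<noteq> - u"
  by (erule unitsE) simp_all

text \<open>The linear functional \<open>Re (z * cnj (emb u))\<close> attains its maximum \<open>1 / 2\<close> on the hexagon exactly on the edge in
direction \<open>u\<close>. The bound \<open>1 / 4\<close> keeps the ends on the other edges and the apexes of the V-shaped lines strictly
below it. Therefore a black line meets this edge only in an end that lies on it.\<close>

lemma black_end_height:
  assumes u: "u \<in> units" and v: "v \<in> units" and e: "\<bar>eps\<bar> \<le> 1 / 4"
  shows "Re (black_end eps u * cnj (emb u)) = 1 / 2"
    and "v \<noteq> u \<Longrightarrow> Re (black_end eps v * cnj (emb u)) < 1 / 2"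
    and "Re (of_real (2 * eps) * \<i> * emb v * cnj (emb u)) < 1 / 2"
proof -
  define w where "w = emb v * cnj (emb u)"
  have "\<bar>eps * Im w\<bar> < 1 / 4"
  proof (cases "eps = 0")
    case False
    have "\<bar>eps * Im w\<bar> = \<bar>eps\<bar> * \<bar>Im w\<bar>"
      by (rule abs_mult)
    also have "\<dots> < \<bar>eps\<bar> * 1"
      using unit_products(2)[OF u v] False by (intro mult_strict_left_mono) (auto simp: w_def)
    finally show ?thesis using e by simp
  qed simp
  then have "- 1 / 4 < eps * Im w" "eps * Im w < 1 / 4"
    by linarith+
  moreover have "Re (black_end eps v * cnj (emb u)) = Re w / 2 - eps * Im w"
    "Re (of_real (2 * eps) * \<i> * emb v * cnj (emb u)) = - 2 * (eps * Im w)"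
    by (simp_all add: black_end_def w_def algebra_simps)
  moreover have "Re w \<le> 1 / 2" if "v \<noteq> u"
    unfolding w_def by (rule unit_products(1)[OF u v that])
  ultimately show "v \<noteq> u \<Longrightarrow> Re (black_end eps v * cnj (emb u)) < 1 / 2"
    "Re (of_real (2 * eps) * \<i> * emb v * cnj (emb u)) < 1 / 2"
    by fastforce+
  have "black_end eps u * cnj (emb u) = (1 / 2 + of_real eps * \<i>) * (emb u * cnj (emb u))"
    by (simp add: black_end_def algebra_simps)
  then show "Re (black_end eps u * cnj (emb u)) = 1 / 2"
    by (simp add: unit_products(3)[OF u u])
qed

lemma black_end_inject:
  assumes u: "u \<in> units" and v: "v \<in> units" and "\<bar>\<sigma>\<bar> \<le> 1 / 4" "\<bar>\<tau>\<bar> \<le> 1 / 4"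
  shows "black_end \<sigma> u = black_end \<tau> v \<longleftrightarrow> \<sigma> = \<tau> \<and> u = v"
proof
  assume eq: "black_end \<sigma> u = black_end \<tau> v"
  then have "u = v"
    using black_end_height(1)[OF u u, of \<sigma>] black_end_height(2)[OF u v, of \<tau>] assms by auto
  moreover have "emb v \<noteq> 0"
    using v by (rule unitsE) (simp_all add: emb_def complex_eq_iff)
  ultimately show "\<sigma> = \<tau> \<and> u = v"
    using eq by (simp add: black_end_def)
qed simp

lemma black_end_leg:
  assumes u: "u \<in> units" and v: "v \<in> units" and w: "w \<in> units"
    and e: "\<bar>\<sigma>\<bar> \<le> 1 / 4" "\<bar>\<tau>\<bar> \<le> 1 / 4" "\<bar>\<rho>\<bar> \<le> 1 / 4"
  shows "black_end \<sigma> u \<in> closed_segment (black_end \<tau> v) (of_real (2 * \<rho>) * \<i> * emb w)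
    \<longleftrightarrow> \<sigma> = \<tau> \<and> u = v" (is "?z \<in> closed_segment ?p ?q \<longleftrightarrow> _")
proof -
  have "?z = ?p" if "?z \<in> closed_segment ?p ?q"
  proof (rule extreme_point_segment[OF that, where a = "cnj (emb u)"])
    show "Re (?p * cnj (emb u)) \<le> Re (?z * cnj (emb u))"
      using black_end_height(1)[OF u u e(1)] black_end_height(1)[OF u u e(2)] black_end_height(2)[OF u v e(2)]
      by (cases "v = u") auto
    show "Re (?q * cnj (emb u)) < Re (?z * cnj (emb u))"
      using black_end_height(1)[OF u u e(1)] black_end_height(3)[OF u w e(3)] by simp
  qed
  then show ?thesis
    using black_end_inject[OF u v e(1,2)] by auto
qed

lemma black_end_stripe:
  assumes u: "u \<in> units" and v: "v \<in> units"
    and e: "\<bar>\<sigma>\<bar> \<le> 1 / 4" "\<bar>\<tau>\<bar> \<le> 1 / 4"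
  shows "black_end \<sigma> u \<in> closed_segment (black_end \<tau> v) (black_end (- \<tau>) (- v))
    \<longleftrightarrow> \<sigma> = \<tau> \<and> u = v \<or> \<sigma> = - \<tau> \<and> u = - v" (is "?z \<in> closed_segment ?p ?q \<longleftrightarrow> _")
proof -
  have e': "\<bar>- \<tau>\<bar> \<le> 1 / 4" and v': "- v \<in> units"
    using e v by (simp_all add: minus_units)
  have hz: "Re (?z * cnj (emb u)) = 1 / 2"
    by (rule black_end_height(1)[OF u u e(1)])
  have hp: "Re (?p * cnj (emb u)) \<le> 1 / 2" "v \<noteq> u \<Longrightarrow> Re (?p * cnj (emb u)) < 1 / 2"
    using black_end_height(1)[OF u u e(2)] black_end_height(2)[OF u v e(2)] by (cases "v = u"; auto)+
  have hq: "Re (?q * cnj (emb u)) \<le> 1 / 2" "- v \<noteq> u \<Longrightarrow> Re (?q * cnj (emb u)) < 1 / 2"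
    using black_end_height(1)[OF u u e'] black_end_height(2)[OF u v' e'] by (cases "- v = u"; auto)+
  have "?z = ?p \<or> ?z = ?q" if z: "?z \<in> closed_segment ?p ?q"
  proof (cases "v = u")
    case True
    then have "- v \<noteq> u"
      using units_nonzero[OF u] by auto
    then show ?thesis
      using extreme_point_segment[OF z, of "cnj (emb u)"] hz hp hq by simp
  next
    case False
    then show ?thesis
      using extreme_point_segment[of ?z ?q ?p "cnj (emb u)"] z hz hp hq
      by (simp add: closed_segment_commute)
  qed
  then show ?thesis
    using black_end_inject[OF u v e] black_end_inject[OF u v' e(1) e'] by auto
qed

fun direction_point :: "direction \<Rightarrow> point" where
  "direction_point Along_a1 = (1, 0)"
| "direction_point Along_a2 = (- 1, 1)"
| "direction_point Along_a1_a2 = (0, 1)"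

fun toward :: "side \<Rightarrow> point \<Rightarrow> point" where
  "toward Left u = u"
| "toward Right u = - u"

text \<open>Reversing the direction vector when the stripe is displaced to its right puts the stripe on the
left of the arrow. The stripe crosses the red half exactly if the two sides agree.\<close>

definition mark :: "tile \<Rightarrow> marked" where
  "mark t = Marked (toward (stripe_side t) (direction_point (stripe_direction t)))
    (stripe_side t = red_side t)"

lemma mark_inject: "mark t = mark t' \<longleftrightarrow> t = t'"
  by (cases t; cases t'; rename_tac d s r d' s' r';
    case_tac d; case_tac s; case_tac r; case_tac d'; case_tac s'; case_tac r'; simp add: mark_def)

lemma direction_units: "direction_point d \<in> units"
  by (cases d) (simp_all add: units_def)

lemma toward_units: "u \<in> units \<Longrightarrow> toward s u \<in> units"
  by (cases s) (simp_all add: minus_units)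

lemma arrow_mark_units: "arrow (mark t) \<in> units"
  by (simp add: mark_def toward_units direction_units)

lemma direction_vector_emb: "direction_vector d = emb (direction_point d)"
  by (cases d) (simp_all add: emb_def a1_def a2_def complex_eq_iff)

lemma vertex_turn: "vertex (turn u) = \<i> * emb u / of_real (sqrt 3)"
proof -
  have "sqrt 3 * (sqrt 3 * x) = 3 * x" for x :: real
    by (simp flip: mult.assoc)
  then show ?thesis
    by (simp add: vertex_def emb_def turn_def complex_eq_iff Re_divide_of_real Im_divide_of_real field_simps)
qed

lemma side_normal_emb: "side_normal d s = \<i> * emb (toward s (direction_point d))"
  by (cases s) (simp_all add: direction_vector_emb emb_minus)

lemma side_vertex_eq: "side_vertex d s = vertex (turn (toward s (direction_point d)))"
  by (simp add: side_vertex_def side_normal_emb vertex_turn)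

lemma stripe_eq:
  "stripe eps t = closed_segment (black_end eps (arrow (mark t))) (black_end (- eps) (- arrow (mark t)))"
  by (cases "stripe_side t")
    (simp_all add: stripe_def mark_def black_end_def Let_def direction_vector_emb emb_minus
      closed_segment_commute algebra_simps doubleton_eq_iff complex_eq_iff)

lemma norm_emb_units: "u \<in> units \<Longrightarrow> norm (emb u) = 1"
  by (erule unitsE) (simp_all add: emb_def cmod_def power_divide)

lemma sgn_scaled: "0 < c \<Longrightarrow> norm z = 1 \<Longrightarrow> sgn (of_real c * z) = (z :: complex)"
  by (simp add: sgn_eq norm_mult)

text \<open>The corner at the vertex \<open>turn u\<close> is the one to the left of \<open>u\<close>; its V-shaped line has its apex at
distance \<open>2 * eps\<close> from the center and its ends on the edges \<open>turn u\<close> and \<open>turn (turn u)\<close>.\<close>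

lemma V_leg_eq:
  assumes u: "u \<in> units"
  shows "V_leg eps (vertex (turn u)) (vertex u) =
      closed_segment (black_end eps (turn u)) (of_real (2 * eps) * \<i> * emb u)"
    and "V_leg eps (vertex (turn u)) (vertex (turn u - u)) =
      closed_segment (black_end (- eps) (turn u - u)) (of_real (2 * eps) * \<i> * emb u)"
proof -
  have s3: "sqrt 3 * (sqrt 3 * x) = 3 * x" for x :: real
    by (simp flip: mult.assoc)
  have mid: "(vertex (turn u) + vertex u) / 2 = emb (turn u) / 2"
    "(vertex (turn u) + vertex (turn u - u)) / 2 = emb (turn u - u) / 2"
    by (simp_all add: vertex_def emb_def turn_def complex_eq_iff field_simps)
  have "vertex (turn u) - emb (turn u) / 2 = of_real (1 / (2 * sqrt 3)) * (\<i> * emb (turn u))"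
    "vertex (turn u) - emb (turn u - u) / 2 = of_real (1 / (2 * sqrt 3)) * (- \<i> * emb (turn u - u))"
    by (simp_all add: vertex_def emb_def turn_def complex_eq_iff field_simps s3)
  then have "sgn (vertex (turn u) - emb (turn u) / 2) = \<i> * emb (turn u)"
    "sgn (vertex (turn u) - emb (turn u - u) / 2) = - \<i> * emb (turn u - u)"
    using norm_emb_units[OF turn_units[OF u]] norm_emb_units[OF turn_turn_units[OF u]]
    by (simp_all only:) (subst sgn_scaled; simp add: norm_mult)+
  moreover have "sgn (vertex (turn u)) = \<i> * emb u"
    using sgn_scaled[of "1 / sqrt 3" "\<i> * emb u"] norm_emb_units[OF u]
    by (simp add: vertex_turn norm_mult)
  ultimately show "V_leg eps (vertex (turn u)) (vertex u) =
      closed_segment (black_end eps (turn u)) (of_real (2 * eps) * \<i> * emb u)"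
    "V_leg eps (vertex (turn u)) (vertex (turn u - u)) =
      closed_segment (black_end (- eps) (turn u - u)) (of_real (2 * eps) * \<i> * emb u)"
    by (simp_all only: V_leg_def Let_def mid black_end_def) (simp_all add: mult.assoc)
qed

lemma vertex_rotate:
  "cis (pi / 3) * vertex u = vertex (turn u)" "cis (- pi / 3) * vertex (turn u) = vertex u"
proof -
  show "cis (pi / 3) * vertex u = vertex (turn u)"
    by (simp add: vertex_def emb_turn algebra_simps)
  then have "cis (- pi / 3) * vertex (turn u) = cis (- pi / 3) * cis (pi / 3) * vertex u"
    by (simp add: mult.assoc)
  then show "cis (- pi / 3) * vertex (turn u) = vertex u"
    by (simp add: cis_mult)
qed


lemma UNIV_side: "UNIV = {Left, Right}"
  using side.exhaust by blast

lemma black_lines_eq: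
  fixes eps t
  defines "j \<equiv> arrow (mark t)"
  shows "black_lines eps t =
    closed_segment (black_end eps j) (black_end (- eps) (- j)) \<union>
    closed_segment (black_end eps (turn j)) (of_real (2 * eps) * \<i> * emb j) \<union>
    closed_segment (black_end (- eps) (turn j - j)) (of_real (2 * eps) * \<i> * emb j) \<union>
    closed_segment (black_end eps (- turn j)) (of_real (2 * eps) * \<i> * emb (- j)) \<union>
    closed_segment (black_end (- eps) (j - turn j)) (of_real (2 * eps) * \<i> * emb (- j))"
proof -
  define V where "V u = V_line eps (vertex (turn u))" for u
  have j: "j \<in> units"
    by (simp add: j_def arrow_mark_units)
  have V: "V u = closed_segment (black_end eps (turn u)) (of_real (2 * eps) * \<i> * emb u) \<union>
    closed_segment (black_end (- eps) (turn u - u)) (of_real (2 * eps) * \<i> * emb u)"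
    if "u \<in> units" for u
    unfolding V_def V_line_def vertex_rotate turn_turn V_leg_eq[OF that] by blast
  have "(\<Union>s. V_line eps (side_vertex (stripe_direction t) s)) =
    V (direction_point (stripe_direction t)) \<union> V (- direction_point (stripe_direction t))"
    unfolding UNIV_side side_vertex_eq V_def by simp
  also have "\<dots> = V j \<union> V (- j)"
    by (cases "stripe_side t") (simp_all add: j_def mark_def Un_commute)
  finally show ?thesis
    unfolding black_lines_def stripe_eq j_def[symmetric] V[OF j] V[OF minus_units[OF j]]
    by (simp add: turn_minus Un_assoc)
qed

text \<open>The six ends of the black lines are pairwise distinct points of the six edges, so each edge
contains exactly one of its two possible ends.\<close>

lemma black_end_in_black_lines:
  assumes "0 < eps" "eps \<le> 1 / 4" and u: "u \<in> units"
  shows "black_end eps u \<in> black_lines eps t \<longleftrightarrow> ccw (mark t) u"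
    and "black_end (- eps) u \<in> black_lines eps t \<longleftrightarrow> \<not> ccw (mark t) u"
proof -
  define j where "j = arrow (mark t)"
  have j: "j \<in> units"
    by (simp add: j_def arrow_mark_units)
  note units = j minus_units[OF j] turn_units[OF j] turn_turn_units[OF j]
    minus_units[OF turn_units[OF j]] minus_units[OF turn_turn_units[OF j]]
  have e: "\<bar>eps\<bar> \<le> 1 / 4" "\<bar>- eps\<bar> \<le> 1 / 4"
    using assms by simp_all
  show "black_end eps u \<in> black_lines eps t \<longleftrightarrow> ccw (mark t) u"
    unfolding black_lines_eq j_def[symmetric]
    using assms units e by (simp add: black_end_leg black_end_stripe u ccw_def del: of_real_mult flip: j_def)
  have "\<not> ccw (mark t) u \<longleftrightarrow> u \<in> {- j, turn j - j, j - turn j}"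
    unfolding ccw_def j_def[symmetric]
    by (rule unitsE[OF u]; rule unitsE[OF j]; simp add: turn_def)
  then show "black_end (- eps) u \<in> black_lines eps t \<longleftrightarrow> \<not> ccw (mark t) u"
    unfolding black_lines_eq j_def[symmetric]
    using assms units e by (simp add: black_end_leg black_end_stripe u del: of_real_mult flip: j_def)
qed

section \<open>The matching rules in lattice coordinates\<close>

lemma hexagon_translate: "hexagon x = (+) x ` hexagon 0"
  unfolding hexagon_def by (simp add: convex_hull_translation)

text \<open>Half the length of a hexagon edge is \<open>1 / (2 * sqrt 3)\<close>, which exceeds \<open>1 / 4\<close>.\<close>

lemma black_end_in_hexagon:
  assumes u: "u \<in> units" and e: "\<bar>eps\<bar> \<le> 1 / 4"
  shows "black_end eps u \<in> hexagon 0"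
proof -
  define s where "s = 1 / 2 + sqrt 3 * eps"
  have "\<bar>sqrt 3 * eps\<bar> \<le> 2 * (1 / 4)"
    unfolding abs_mult using e by (intro mult_mono) (auto simp: real_le_lsqrt)
  then have s: "0 \<le> s" "s \<le> 1"
    by (auto simp: s_def abs_if split: if_splits)
  have "sqrt 3 * (sqrt 3 * x) = 3 * x" for x :: real
    by (simp flip: mult.assoc)
  then have "black_end eps u = s *\<^sub>R vertex u + (1 - s) *\<^sub>R vertex (u - turn u)"
    by (simp add: black_end_def vertex_def s_def emb_def turn_def complex_eq_iff field_simps)
  moreover have "vertex u \<in> Omega" "vertex (u - turn u) \<in> Omega"
    using vertex_Omega[OF u] vertex_Omega[OF minus_units[OF turn_turn_units[OF u]]] by simp_all
  ultimately show ?thesis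
    unfolding hexagon_def using s by (auto intro: convexD[OF convex_convex_hull] hull_inc)
qed

lemma R1_edge:
  assumes R1: "R1 eps \<Lambda>" and eps: "0 < eps" "eps \<le> 1 / 4" and u: "u \<in> units"
  shows "ccw (mark (\<Lambda> (emb p))) u \<noteq> ccw (mark (\<Lambda> (emb (p + u)))) (- u)"
proof -
  \<comment> \<open>The end on the common edge that is counterclockwise as seen from \<open>p\<close> is clockwise as seen
    from the other side.\<close>
  define z where "z = emb p + black_end eps u"
  have z: "z = emb (p + u) + black_end (- eps) (- u)"
    by (simp add: z_def black_end_def emb_add emb_minus)
  have e: "\<bar>eps\<bar> \<le> 1 / 4" "\<bar>- eps\<bar> \<le> 1 / 4"
    using eps by simp_all
  have "z \<in> hexagon (emb p)"
    unfolding z_def by (subst hexagon_translate) (intro imageI black_end_in_hexagon u e)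
  moreover have "z \<in> hexagon (emb (p + u))"
    unfolding z by (subst hexagon_translate) (intro imageI black_end_in_hexagon minus_units u e)
  moreover have "(+) (emb p) ` black_lines eps (\<Lambda> (emb p)) \<inter> (hexagon (emb p) \<inter> hexagon (emb (p + u))) =
    (+) (emb (p + u)) ` black_lines eps (\<Lambda> (emb (p + u))) \<inter> (hexagon (emb p) \<inter> hexagon (emb (p + u)))"
    using R1 adjacent_emb[OF u, of "emb p"]
    unfolding R1_def Let_def Q_lattice_eq emb_add[symmetric] by blast
  ultimately have "z \<in> (+) (emb p) ` black_lines eps (\<Lambda> (emb p)) \<longleftrightarrow>
      z \<in> (+) (emb (p + u)) ` black_lines eps (\<Lambda> (emb (p + u)))"
    by blast
  moreover have "z \<in> (+) (emb p) ` black_lines eps t \<longleftrightarrow> ccw (mark t) u" for t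
    using black_end_in_black_lines(1)[OF eps u, of t] by (auto simp: z_def)
  moreover have "z \<in> (+) (emb (p + u)) ` black_lines eps t \<longleftrightarrow> \<not> ccw (mark t) (- u)" for t
    using black_end_in_black_lines(2)[OF eps minus_units[OF u], of t] by (auto simp: z)
  ultimately show ?thesis by blast
qed


lemma norm_vertex: "u \<in> units \<Longrightarrow> norm (vertex u) = 1 / sqrt 3"
proof -
  assume u: "u \<in> units"
  define v where "v = u - turn u"
  have "v \<in> units"
    using minus_units[OF turn_turn_units[OF u]] by (simp add: v_def)
  then have "norm (vertex (turn v)) = 1 / sqrt 3"
    unfolding vertex_turn by (simp add: norm_divide norm_mult norm_emb_units)
  moreover have "turn v = u"
    by (simp add: v_def turn_def prod_eq_iff)
  ultimately show ?thesis by simp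
qed

text \<open>All vertices of the hexagon have the same distance from the center, so a diagonal or a half of it contains
no vertices but its own ends.\<close>

lemma extreme_point_radius:
  fixes a x :: "'a::real_normed_vector"
  assumes "x \<in> closed_segment 0 a" "norm x = norm a"
  shows "x = a"
proof -
  obtain t where t: "0 \<le> t" "t \<le> 1" "x = t *\<^sub>R a"
    using assms(1) by (auto simp: closed_segment_def)
  with assms(2) show ?thesis by (cases "a = 0") auto
qed

lemma extreme_point_diameter:
  fixes a x :: "'a::real_normed_vector"
  assumes "x \<in> closed_segment (- a) a" "norm x = norm a"
  shows "x = a \<or> x = - a"
proof -
  obtain t where t: "0 \<le> t" "t \<le> 1" "x = (1 - t) *\<^sub>R (- a) + t *\<^sub>R a"
    using assms(1) by (auto simp: closed_segment_def)
  then have x: "x = (2 * t - 1) *\<^sub>R a"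
    by (simp add: algebra_simps scaleR_2 flip: scaleR_scaleR)
  show ?thesis
  proof (cases "a = 0")
    case False
    with assms(2) x have "2 * t - 1 = 1 \<or> 2 * t - 1 = - 1"
      by (auto simp: abs_if split: if_splits)
    then show ?thesis
      unfolding x by (metis scaleR_minus1_left scaleR_one)
  qed (use x in simp)
qed

lemma vertex_on_radius:
  "u \<in> units \<Longrightarrow> v \<in> units \<Longrightarrow> vertex u \<in> closed_segment 0 (vertex v) \<longleftrightarrow> u = v"
  using extreme_point_radius[of "vertex u" "vertex v"] by (auto simp: norm_vertex vertex_inject)

lemma vertex_on_diameter:
  "u \<in> units \<Longrightarrow> v \<in> units \<Longrightarrow>
    vertex u \<in> closed_segment (- vertex v) (vertex v) \<longleftrightarrow> u = v \<or> u = - v"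
  using extreme_point_diameter[of "vertex u" "vertex v"]
  by (auto simp: norm_vertex vertex_inject vertex_minus[symmetric])

lemma vertex_cis:
  "cis (pi / 6) * emb u / of_real (sqrt 3) = vertex u"
  "cis (- pi / 6) * emb u / of_real (sqrt 3) = vertex (u - turn u)"
proof -
  have s3: "sqrt 3 * (sqrt 3 * x) = 3 * x" for x :: real
    by (simp flip: mult.assoc)
  show "cis (pi / 6) * emb u / of_real (sqrt 3) = vertex u"
    "cis (- pi / 6) * emb u / of_real (sqrt 3) = vertex (u - turn u)"
    by (simp_all add: vertex_def emb_def turn_def complex_eq_iff Re_divide_of_real Im_divide_of_real
        cos_30 sin_30 field_simps s3)
qed

lemma long_diagonal_eq:
  "long_diagonal (cis (pi / 6) * emb u) = closed_segment (- vertex u) (vertex u)"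
  "long_diagonal (cis (- pi / 6) * emb u) = closed_segment (- vertex (u - turn u)) (vertex (u - turn u))"
proof -
  have *: "long_diagonal z = closed_segment (- (z / of_real (sqrt 3))) (z / of_real (sqrt 3))" for z
    by (simp add: long_diagonal_def)
  show "long_diagonal (cis (pi / 6) * emb u) = closed_segment (- vertex u) (vertex u)"
    "long_diagonal (cis (- pi / 6) * emb u) = closed_segment (- vertex (u - turn u)) (vertex (u - turn u))"
    unfolding * vertex_cis by (rule refl)+
qed

lemma vertex_in_red_lines:
  assumes u: "u \<in> units"
  shows "vertex u \<in> red_lines t \<longleftrightarrow> red (mark t) u"
proof -
  define d where "d = direction_point (stripe_direction t)"
  have d: "d \<in> units" "turn (toward s d) \<in> units" "d - turn d \<in> units" for s
    using direction_units minus_units[OF turn_turn_units[OF direction_units]]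
    by (simp_all add: d_def toward_units turn_units)
  have "vertex u \<in> red_lines t \<longleftrightarrow>
      (u = d - turn d \<or> u = - (d - turn d)) \<or> u = turn (toward (red_side t) d)"
    unfolding red_lines_def red_half_def direction_vector_emb side_vertex_eq d_def[symmetric]
      long_diagonal_eq Un_iff vertex_on_diameter[OF u d(3)] vertex_on_radius[OF u d(2)] ..
  also have "\<dots> \<longleftrightarrow> red (mark t) u"
    by (cases "stripe_side t"; cases "red_side t")
      (auto simp: red_def mark_def d_def[symmetric] turn_turn turn_minus)
  finally show ?thesis .
qed

lemma vertex_in_blue_lines:
  assumes u: "u \<in> units"
  shows "vertex u \<in> blue_lines t \<longleftrightarrow> \<not> red (mark t) u"
proof -
  define d where "d = direction_point (stripe_direction t)"
  have d: "d \<in> units" "turn (toward s d) \<in> units" for s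
    using direction_units by (simp_all add: d_def toward_units turn_units)
  have "vertex u \<in> blue_lines t \<longleftrightarrow>
      (u = d \<or> u = - d) \<or> u = turn (toward (opposite_side (red_side t)) d)"
    unfolding blue_lines_def blue_half_def direction_vector_emb side_vertex_eq d_def[symmetric]
      long_diagonal_eq Un_iff vertex_on_diameter[OF u d(1)] vertex_on_radius[OF u d(2)] ..
  also have "\<dots> \<longleftrightarrow> \<not> red (mark t) u"
    by (cases "stripe_side t"; cases "red_side t";
        simp add: red_def mark_def d_def[symmetric] turn_turn turn_minus;
        rule unitsE[OF u]; rule unitsE[OF d(1)]; simp add: turn_def)
  finally show ?thesis .
qed

lemma R2_diagonal:
  assumes R2: "R2 \<Lambda>" and u: "u \<in> units"
  shows "red (mark (\<Lambda> (emb p))) u \<noteq> red (mark (\<Lambda> (emb (p + u + turn u)))) (- u)"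
proof -
  have "emb p + 3 * vertex u = emb (p + u + turn u)"
    by (simp add: vertex_def emb_add)
  then show ?thesis
    using R2 vertex_Omega[OF u] vertex_in_red_lines[OF u] vertex_in_blue_lines[OF u]
      vertex_in_red_lines[OF minus_units[OF u]] vertex_in_blue_lines[OF minus_units[OF u]]
    unfolding R2_def Q_lattice_eq vertex_minus by (metis rangeI)
qed

lemma valid_mark:
  assumes "0 < eps" "eps \<le> 1 / 4" "\<Lambda> \<in> X_Q eps"
  shows "valid (\<lambda>p. mark (\<Lambda> (emb p)))"
  unfolding valid_def using assms R1_edge R2_diagonal arrow_mark_units by (auto simp: X_Q_def)

section \<open>Parity and local derivability\<close>

text \<open>If stripe and red half are on the same side, they meet at distance \<open>eps\<close> from the center. Otherwise
the line through the center parallel to the stripe separates them.\<close>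

lemma tile_parity_mark:
  assumes "0 < eps" "eps \<le> 1 / 4"
  shows "tile_parity eps t = (if white (mark t) then White else Gray)"
proof -
  define d where "d = direction_vector (stripe_direction t)"
  define n where "n s = side_normal (stripe_direction t) s" for s
  have d: "d * cnj d = 1"
    using unit_products(3)[OF direction_units direction_units] by (simp add: d_def direction_vector_emb)
  have stripe: "stripe eps t = closed_segment (- d / 2 + of_real eps * n (stripe_side t)) (d / 2 + of_real eps * n (stripe_side t))"
    by (simp add: stripe_def Let_def d_def n_def)
  have red: "red_half t = closed_segment 0 (n (red_side t) / of_real (sqrt 3))"
    by (simp add: red_half_def side_vertex_def n_def)
  show ?thesis
  proof (cases "stripe_side t = red_side t")
    case True
    have "of_real eps * n (red_side t) = midpoint (- d / 2 + of_real eps * n (stripe_side t)) (d / 2 + of_real eps * n (stripe_side t))"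
      by (simp add: midpoint_def True scaleR_conv_of_real)
    then have "of_real eps * n (red_side t) \<in> stripe eps t"
      unfolding stripe by (simp only: midpoint_in_closed_segment)
    moreover have "of_real eps * n (red_side t) \<in> red_half t"
    proof -
      have "sqrt 3 * eps \<le> 2 * (1 / 4)"
        using assms by (intro mult_mono) (auto simp: real_le_lsqrt)
      then have "of_real eps * n (red_side t) = (1 - sqrt 3 * eps) *\<^sub>R 0 + (sqrt 3 * eps) *\<^sub>R (n (red_side t) / of_real (sqrt 3))"
        "0 \<le> sqrt 3 * eps" "sqrt 3 * eps \<le> 1"
        using assms by (simp_all add: scaleR_conv_of_real)
      then show ?thesis
        unfolding red closed_segment_def by blast
    qed
    ultimately show ?thesis
      using True by (auto simp: tile_parity_def mark_def)
  next
    case False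
    then have opp: "n (red_side t) = - n (stripe_side t)"
      by (cases "stripe_side t"; cases "red_side t") (simp_all add: n_def)
    \<comment> \<open>The signed distance from the line through the center parallel to the stripe.\<close>
    define f where "f z = Re (z * cnj (n (stripe_side t)))" for z
    have n: "n (stripe_side t) = \<i> * d \<or> n (stripe_side t) = - \<i> * d"
      by (cases "stripe_side t") (simp_all add: n_def d_def)
    have nn: "n (stripe_side t) * cnj (n (stripe_side t)) = 1"
    proof -
      have "\<i> * d * cnj (\<i> * d) = d * cnj d" "- \<i> * d * cnj (- \<i> * d) = d * cnj d"
        by (simp_all add: complex_eq_iff)
      with n d show ?thesis by metis
    qed
    have dn: "d * cnj (n (stripe_side t)) = - \<i> \<or> d * cnj (n (stripe_side t)) = \<i>"
      using n d by (auto simp: mult.left_commute[of d])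
    have "f z = eps" if z: "z \<in> stripe eps t" for z
    proof -
      obtain s where "z = (1 - s) *\<^sub>R (- d / 2 + of_real eps * n (stripe_side t)) + s *\<^sub>R (d / 2 + of_real eps * n (stripe_side t))"
        using z unfolding stripe closed_segment_def by blast
      then have "z = of_real (s - 1 / 2) * d + of_real eps * n (stripe_side t)"
        by (simp add: complex_eq_iff field_simps)
      then have "z * cnj (n (stripe_side t)) =
          of_real (s - 1 / 2) * (d * cnj (n (stripe_side t))) + of_real eps * (n (stripe_side t) * cnj (n (stripe_side t)))"
        by (simp only: distrib_right mult.assoc)
      then have eq: "z * cnj (n (stripe_side t)) =
          of_real (s - 1 / 2) * (d * cnj (n (stripe_side t))) + of_real eps"
        by (simp only: nn mult_1_right)
      show ?thesis
        using dn unfolding f_def eq by (elim disjE; simp only:) simp_all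
    qed
    moreover have "f z \<le> 0" if z: "z \<in> red_half t" for z
    proof -
      obtain s where s: "0 \<le> s" and z: "z = s *\<^sub>R (- n (stripe_side t) / of_real (sqrt 3))"
        using z unfolding red opp closed_segment_def by auto
      have "z * cnj (n (stripe_side t)) = - of_real (s / sqrt 3) * (n (stripe_side t) * cnj (n (stripe_side t)))"
        by (simp add: z scaleR_conv_of_real)
      then show ?thesis
        using s unfolding f_def nn by simp
    qed
    ultimately have "stripe eps t \<inter> red_half t = {}"
      using assms(1) by force
    then show ?thesis
      using False by (simp add: tile_parity_def mark_def)
  qed
qed


lemma norm_emb_le:
  assumes "\<bar>fst p\<bar> \<le> N" "\<bar>snd p\<bar> \<le> N"
  shows "norm (emb p) \<le> 3 * of_int N"
proof -
  have "\<bar>real_of_int (fst p)\<bar> \<le> of_int N" "\<bar>real_of_int (snd p)\<bar> \<le> of_int N"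
    using assms by linarith+
  moreover have "\<bar>real_of_int (snd p)\<bar> * sqrt 3 \<le> \<bar>real_of_int (snd p)\<bar> * 2"
    by (intro mult_left_mono) (auto simp: real_le_lsqrt)
  moreover have "norm (emb p) \<le> \<bar>Re (emb p)\<bar> + \<bar>Im (emb p)\<bar>"
    by (rule cmod_le)
  moreover have "\<bar>Re (emb p)\<bar> \<le> \<bar>real_of_int (fst p)\<bar> + \<bar>real_of_int (snd p)\<bar> / 2"
    by (simp add: emb_def)
  moreover have "\<bar>Im (emb p)\<bar> = \<bar>real_of_int (snd p)\<bar> * sqrt 3 / 2"
    by (simp add: emb_def abs_mult)
  ultimately show ?thesis
    by linarith
qed

lemma valid_shift:
  assumes T: "valid T"
  shows "valid (\<lambda>v. T (p + v))"
  unfolding valid_def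
proof (intro conjI allI ballI)
  fix v u
  show "arrow (T (p + v)) \<in> units"
    by (rule valid_arrow[OF T])
  show "ccw (T (p + v)) u \<noteq> ccw (T (p + (v + u))) (- u)" if "u \<in> units"
    by (rule valid_edge[OF T that]) (simp add: add.assoc)
  show "red (T (p + v)) u \<noteq> red (T (p + (v + u + turn u))) (- u)" if "u \<in> units"
    by (rule valid_diagonal[OF T that]) (simp add: add.assoc)
qed

theorem corollary9p1:
  fixes eps :: real and \<Lambda> :: "complex \<Rightarrow> tile"
  assumes "0 < eps" and "eps \<le> 1 / 4"
    and "\<Lambda> \<in> X_Q eps"
  shows "mutually_locally_derivable \<Lambda> (parity_tiling eps \<Lambda>)"
proof -
  have "locally_derivable_from (parity_tiling eps \<Lambda>) \<Lambda>"
    unfolding locally_derivable_from_def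
  proof (intro exI[of _ 1] conjI ballI impI)
    fix x y
    assume "x \<in> Q_lattice" and same: "\<forall>z\<in>Q_lattice \<inter> cball x 1. \<Lambda> z = \<Lambda> (z + (y - x))"
    then have "\<Lambda> x = \<Lambda> (x + (y - x))"
      by (intro same[rule_format]) simp
    then show "parity_tiling eps \<Lambda> x = parity_tiling eps \<Lambda> y"
      by (simp add: parity_tiling_def)
  qed simp
  moreover have "locally_derivable_from \<Lambda> (parity_tiling eps \<Lambda>)"
    unfolding locally_derivable_from_def
    \<comment> \<open>Lattice points with coordinates up to 50 have norm at most 150.\<close>
  proof (intro exI[of _ 150] conjI ballI impI)
    fix x y
    assume "x \<in> Q_lattice" "y \<in> Q_lattice"
      and same: "\<forall>z\<in>Q_lattice \<inter> cball x 150. parity_tiling eps \<Lambda> z = parity_tiling eps \<Lambda> (z + (y - x))"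
    then obtain p q where x: "x = emb p" and y: "y = emb q"
      by (auto simp: Q_lattice_eq)
    define T where "T p = mark (\<Lambda> (emb p))" for p
    have T: "valid T"
      unfolding T_def by (rule valid_mark[OF assms])
    have "agree 50 (\<lambda>v. T (p + v)) (\<lambda>v. T (q + v))"
      unfolding agree_def
    proof (intro allI impI)
      fix v :: point
      assume "\<bar>fst v\<bar> \<le> 50" "\<bar>snd v\<bar> \<le> 50"
      then have "norm (emb v) \<le> 150"
        using norm_emb_le[of v 50] by simp
      then have "emb (p + v) \<in> cball x 150"
        by (simp add: x emb_add dist_norm)
      then have "emb (p + v) \<in> Q_lattice \<inter> cball x 150"
        by (simp add: Q_lattice_eq)
      then have "parity_tiling eps \<Lambda> (emb (p + v)) = parity_tiling eps \<Lambda> (emb (p + v) + (y - x))"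
        using same by blast
      moreover have "emb (p + v) + (y - x) = emb (q + v)"
        by (simp add: x y emb_add)
      ultimately show "white (T (p + v)) = white (T (q + v))"
        by (auto simp: parity_tiling_def tile_parity_mark[OF assms(1,2)] T_def split: if_splits)
    qed
    then have "T (p + 0) = T (q + 0)"
      by (rule white_determines[OF valid_shift[OF T] valid_shift[OF T]])
    then show "\<Lambda> x = \<Lambda> y"
      by (simp add: T_def mark_inject x y)
  qed simp
  ultimately show ?thesis
    by (simp add: mutually_locally_derivable_def)
qed

end
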